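(* Let $n\ge 2$ be an integer, let $(a,b)\subset\mathbb{R}$ be an open interval and $f:(a,b)\to\mathbb{R}$. If $f$ is $n$-monotone, then $f$ is $(2n-1)$-tone, and in particular $f\in C^{2n-3}(a,b)$. If $f$ is $n$-convex, then $f$ is $(2n)$-tone, and in particular $f\in C^{2n-2}(a,b)$.
   Context: Matrices are ordered by the Loewner order: $A\le B$ iff $B-A$ is positive semidefinite; $f(A)$ is defined by the functional calculus. A function $f:(a,b)\to\mathbb{R}$ is $n$-monotone if for all $n\times n$ (complex) Hermitian matrices $A\le B$ with all eigenvalues in $(a,b)$ one has $f(A)\le f(B)$. It is $n$-convex if for all $t\in[0,1]$ and all $n\times n$ Hermitian matrices $A,B$ with all eigenvalues in $(a,b)$ one has $f(tA+(1-t)B)\le tf(A)+(1-t)f(B)$. For pairwise distinct points, $[\lambda_0,\ldots,\lambda_k]_f=\sum_{i=0}^{k}\frac{f(\lambda_i)}{\prod_{j\ne i}(\lambda_i-\lambda_j)}$ is the divided difference of order $k$. A function $f$ on $(a,b)$ is $k$-tone if $[\lambda_0,\ldots,\lambda_k]_f\ge 0$ for all pairwise distinct $\lambda_0,\ldots,\lambda_k\in(a,b)$. *)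

theory Defs
  imports
    "Jordan_Normal_Form.Spectral_Radius"
    "Jordan_Normal_Form.Schur_Decomposition"
    "HOL-Analysis.Interval_Integral"
begin

no_notation Finite_Cartesian_Product.vec_nth (infixl \<open>$\<close> 90)
hide_const (open) Finite_Cartesian_Product.vec

section \<open>Hermitian matrices, Loewner order, functional calculus\<close>

definition hermitian_mats :: "nat \<Rightarrow> complex mat set" where
  "hermitian_mats n = {A \<in> carrier_mat n n. mat_adjoint A = A}"

definition hermitian_mats_on :: "nat \<Rightarrow> real set \<Rightarrow> complex mat set" where
  "hermitian_mats_on n I = {A \<in> hermitian_mats n. spectrum A \<subseteq> complex_of_real ` I}"

text \<open>The inequality below is in the order on complex numbers for which \<open>0 \<le> z\<close> means that
  \<open>z\<close> is real and nonnegative.\<close>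

definition pos_semidef :: "nat \<Rightarrow> complex mat \<Rightarrow> bool" where
  "pos_semidef n A \<longleftrightarrow> A \<in> hermitian_mats n \<and> (\<forall>v \<in> carrier_vec n. 0 \<le> (A *\<^sub>v v) \<bullet>c v)"

definition loewner_le :: "nat \<Rightarrow> complex mat \<Rightarrow> complex mat \<Rightarrow> bool" where
  "loewner_le n A B \<longleftrightarrow> A \<in> hermitian_mats n \<and> B \<in> hermitian_mats n \<and> pos_semidef n (B - A)"

definition unitary_mats :: "nat \<Rightarrow> complex mat set" where
  "unitary_mats n =
     {U \<in> carrier_mat n n. U * mat_adjoint U = 1\<^sub>m n \<and> mat_adjoint U * U = 1\<^sub>m n}"

definition unitary_conj :: "nat \<Rightarrow> complex mat \<Rightarrow> (nat \<Rightarrow> real) \<Rightarrow> complex mat" where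
  "unitary_conj n U d = U * mat_diag n (\<lambda>i. complex_of_real (d i)) * mat_adjoint U"

text \<open>The matrix \<open>f(A)\<close>, for \<open>A\<close> Hermitian: if \<open>A = U diag(d) U\<^sup>*\<close> with \<open>U\<close> unitary, then
  \<open>f(A) = U diag(f \<circ> d) U\<^sup>*\<close>. Such a diagonalization exists by the spectral theorem, and the
  result does not depend on it by the lemma \<open>matrix_fun_unitary_conj\<close> below.\<close>

definition matrix_fun :: "(real \<Rightarrow> real) \<Rightarrow> complex mat \<Rightarrow> complex mat" where
  "matrix_fun f A = (THE B. \<exists>U d. U \<in> unitary_mats (dim_row A) \<and>
     A = unitary_conj (dim_row A) U d \<and> B = unitary_conj (dim_row A) U (f \<circ> d))"

lemma mat_adjoint_carrier: "U \<in> carrier_mat n m \<Longrightarrow> mat_adjoint U \<in> carrier_mat m n"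
  by (auto simp: mat_adjoint_def mat_of_rows_def)

lemma unitary_conj_fun_unique:
  assumes U: "U \<in> unitary_mats n" and V: "V \<in> unitary_mats n"
    and eq: "unitary_conj n U d = unitary_conj n V e"
  shows "unitary_conj n U (f \<circ> d) = unitary_conj n V (f \<circ> e)"
proof -
  let ?D = "\<lambda>d :: nat \<Rightarrow> real. mat_diag n (\<lambda>i. complex_of_real (d i))"
  have c [simp]: "U \<in> carrier_mat n n" "mat_adjoint U \<in> carrier_mat n n"
      "V \<in> carrier_mat n n" "mat_adjoint V \<in> carrier_mat n n" "\<And>d. ?D d \<in> carrier_mat n n"
    using U V by (auto simp: unitary_mats_def mat_adjoint_carrier)
  have u: "U * mat_adjoint U = 1\<^sub>m n" "mat_adjoint U * U = 1\<^sub>m n"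
      "V * mat_adjoint V = 1\<^sub>m n" "mat_adjoint V * V = 1\<^sub>m n"
    using U V by (auto simp: unitary_mats_def)
  define W where "W = mat_adjoint V * U"
  have W [simp]: "W \<in> carrier_mat n n" unfolding W_def by (rule mult_carrier_mat[of _ n n]) auto
  note [simp] = assoc_mult_mat[of _ n n _ n _ n] mult_carrier_mat[of _ n n _ n]
    right_mult_one_mat[of _ n n] left_mult_one_mat[of _ n n]
  have "W * ?D d = mat_adjoint V * unitary_conj n U d * U"
    by (simp add: W_def unitary_conj_def u)
  also have "\<dots> = mat_adjoint V * (V * (?D e * W))"
    unfolding eq by (simp add: W_def unitary_conj_def)
  also have "\<dots> = (mat_adjoint V * V) * (?D e * W)" by simp
  also have "\<dots> = ?D e * W"
    unfolding u(4) by (rule left_mult_one_mat[of _ n n]) simp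
  finally have *: "W * ?D d = ?D e * W" .
  have "W * ?D (f \<circ> d) = ?D (f \<circ> e) * W"
  proof (rule eq_matI)
    fix i j assume "i < dim_row (?D (f \<circ> e) * W)" "j < dim_col (?D (f \<circ> e) * W)"
    then have ij: "i < n" "j < n" using W by (auto simp: mat_diag_def)
    have "W $$ (i, j) * d j = e i * W $$ (i, j)"
      using arg_cong[OF *, of "\<lambda>M. M $$ (i, j)"] ij
      by (simp add: mat_diag_mult_left[of _ n n] mat_diag_mult_right[of _ n n])
    then have "W $$ (i, j) = 0 \<or> d j = e i" by (simp add: mult.commute)
    then show "(W * ?D (f \<circ> d)) $$ (i, j) = (?D (f \<circ> e) * W) $$ (i, j)"
      using ij by (auto simp: mat_diag_mult_left[of _ n n] mat_diag_mult_right[of _ n n])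
  qed (use carrier_matD[OF W] in \<open>simp_all add: mat_diag_def\<close>)
  then have "V * (W * ?D (f \<circ> d)) * mat_adjoint U = V * (?D (f \<circ> e) * W) * mat_adjoint U"
    by simp
  also have "V * (W * ?D (f \<circ> d)) * mat_adjoint U
      = (V * mat_adjoint V) * unitary_conj n U (f \<circ> d)"
    by (simp add: W_def unitary_conj_def)
  also have "\<dots> = unitary_conj n U (f \<circ> d)"
    unfolding u(3) by (rule left_mult_one_mat[of _ n n]) (simp add: unitary_conj_def)
  also have "V * (?D (f \<circ> e) * W) * mat_adjoint U = unitary_conj n V (f \<circ> e)"
    by (simp add: W_def unitary_conj_def u right_mult_one_mat[of _ n n])
  finally show ?thesis .
qed

lemma matrix_fun_unitary_conj:
  assumes "U \<in> unitary_mats n"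
  shows "matrix_fun f (unitary_conj n U d) = unitary_conj n U (f \<circ> d)"
proof -
  have "dim_row (unitary_conj n U d) = n"
    using assms by (auto simp: unitary_conj_def unitary_mats_def)
  then show ?thesis
    unfolding matrix_fun_def using assms
    by (intro the_equality) (auto intro: unitary_conj_fun_unique)
qed

section \<open>Matrix monotone, matrix convex, and k-tone functions\<close>

text \<open>In all that follows, \<open>I\<close> is an open interval and \<open>f\<close> matters only on \<open>I\<close>.\<close>

definition matrix_monotone_on :: "nat \<Rightarrow> real set \<Rightarrow> (real \<Rightarrow> real) \<Rightarrow> bool" where
  "matrix_monotone_on n I f \<longleftrightarrow>
     (\<forall>A \<in> hermitian_mats_on n I. \<forall>B \<in> hermitian_mats_on n I.
        loewner_le n A B \<longrightarrow> loewner_le n (matrix_fun f A) (matrix_fun f B))"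

definition matrix_convex_on :: "nat \<Rightarrow> real set \<Rightarrow> (real \<Rightarrow> real) \<Rightarrow> bool" where
  "matrix_convex_on n I f \<longleftrightarrow>
     (\<forall>t \<in> {0..1}. \<forall>A \<in> hermitian_mats_on n I. \<forall>B \<in> hermitian_mats_on n I.
        loewner_le n
          (matrix_fun f (complex_of_real t \<cdot>\<^sub>m A + complex_of_real (1 - t) \<cdot>\<^sub>m B))
          (complex_of_real t \<cdot>\<^sub>m matrix_fun f A + complex_of_real (1 - t) \<cdot>\<^sub>m matrix_fun f B))"

definition divided_difference :: "(real \<Rightarrow> real) \<Rightarrow> nat \<Rightarrow> (nat \<Rightarrow> real) \<Rightarrow> real" where
  "divided_difference f k l = (\<Sum>i\<le>k. f (l i) / (\<Prod>j \<in> {..k} - {i}. l i - l j))"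

definition k_tone_on :: "nat \<Rightarrow> real set \<Rightarrow> (real \<Rightarrow> real) \<Rightarrow> bool" where
  "k_tone_on k I f \<longleftrightarrow>
     (\<forall>l :: nat \<Rightarrow> real. inj_on l {..k} \<and> l ` {..k} \<subseteq> I \<longrightarrow> divided_difference f k l \<ge> 0)"

text \<open>The class \<open>C\<^sup>k(I)\<close>, for open \<open>I\<close>; as \<open>I\<close> is open, the iterated derivatives on \<open>I\<close> depend
  only on the values of \<open>f\<close> on \<open>I\<close>.\<close>

definition C_k_on :: "nat \<Rightarrow> real set \<Rightarrow> (real \<Rightarrow> real) \<Rightarrow> bool" where
  "C_k_on k I f \<longleftrightarrow>
     (\<forall>i<k. \<forall>x\<in>I. (deriv ^^ i) f differentiable (at x)) \<and> continuous_on I ((deriv ^^ k) f)"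

end

theory Submission
  imports Defs "HOL-Analysis.Lipschitz" "HOL-Analysis.Equivalence_Measurable_On_Borel"
begin

text \<open>
  Up to translation and scaling, one pair of Hermitian matrices for monotonicity and one triple for
  convexity suffice; the rest is real analysis. Let \<open>S\<^sub>\<sigma>\<close> be the adjacency matrix of a path with \<open>n\<close> vertices and a loop of weight \<open>\<sigma>\<close> at one
  end, and let \<open>w\<close> be the coordinate vector of the other end. Then \<open>\<langle>S\<^sub>\<sigma> ^ m w, w\<rangle>\<close> counts closed walks of
  length \<open>m\<close> at \<open>w\<close>, weighted by powers of \<open>\<sigma>\<close>. A walk has to travel to the other end and back to feel the
  loop, so this number is independent of \<open>\<sigma>\<close> for \<open>m \<le> 2 n - 2\<close>, it is \<open>const + \<sigma>\<close> for \<open>m = 2 n - 1\<close>, and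
  \<open>const + const \<sigma> + \<sigma>\<^sup>2\<close> for \<open>m = 2 n\<close> (lemma \<open>path_mat_moments\<close>). Put \<open>A\<^sub>\<sigma> = x 1 + e S\<^sub>\<sigma>\<close> with \<open>e > 0\<close>.
  If \<open>f\<close> is \<open>n\<close>-monotone, then \<open>A\<^sub>0 \<le> A\<^sub>1\<close> gives \<open>\<langle>f(A\<^sub>1) w, w\<rangle> - \<langle>f(A\<^sub>0) w, w\<rangle> \<ge> 0\<close>; if \<open>f\<close> is \<open>n\<close>-convex,
  then \<open>A\<^sub>0 = (A\<^sub>1 + A\<^sub>-\<^sub>1) / 2\<close> gives \<open>(\<langle>f(A\<^sub>1) w, w\<rangle> + \<langle>f(A\<^sub>-\<^sub>1) w, w\<rangle>) / 2 - \<langle>f(A\<^sub>0) w, w\<rangle> \<ge> 0\<close>. In both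
  cases this is an inequality \<open>\<Sum> c\<^sub>i f(x + e p\<^sub>i) \<ge> 0\<close>, with the fixed eigenvalues \<open>p\<^sub>i\<close> of the \<open>S\<^sub>\<sigma>\<close>, for all
  \<open>x\<close> and \<open>e\<close> for which the nodes stay in the interval. With \<open>k = 2 n - 1\<close> or \<open>k = 2 n\<close>, respectively, the
  moments \<open>\<Sum> c\<^sub>i p\<^sub>i ^ m\<close> vanish for \<open>m < k\<close> and the one for \<open>m = k\<close> is positive.

  For smooth \<open>f\<close> such a stencil forces the \<open>k\<close>-th derivative to be nonnegative as \<open>e\<close> tends to 0. In general,
  apply the stencil to a \<open>k\<close>-fold antiderivative of \<open>f\<close>: the result has a nonnegative \<open>k\<close>-th derivative
  in \<open>x\<close>, hence nonnegative divided differences of order \<open>k\<close>, and divided by \<open>e ^ k\<close> it converges to a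
  positive multiple of \<open>f\<close> (lemma \<open>stencil_imp_k_tone\<close>). This needs \<open>f\<close> continuous. An \<open>n\<close>-convex
  function is convex, hence continuous; an \<open>n\<close>-monotone function is monotone, and passing through its
  integral means yields continuity together with the conclusion (lemma \<open>mono_stencil_imp_k_tone\<close>).

  Regularity holds for every \<open>k\<close>-tone function with \<open>k \<ge> 2\<close> (lemma \<open>k_tone_imp_C_k\<close>): its divided
  differences of orders below \<open>k\<close> are locally bounded, so it is continuous, and differentiable if
  \<open>k \<ge> 3\<close>, in which case its derivative is \<open>(k - 1)\<close>-tone.
\<close>

section \<open>Divided differences over finite sets of nodes\<close>

text \<open>A divided difference is symmetric in its nodes, so it is a function of the set of nodes. In this
  form exchanging one node, or merging two node sets, needs no bookkeeping of indices.\<close>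

definition divdiff :: "(real \<Rightarrow> real) \<Rightarrow> real set \<Rightarrow> real" where
  "divdiff f S = (\<Sum>x\<in>S. f x / (\<Prod>y\<in>S - {x}. x - y))"

lemma divided_difference_eq_divdiff:
  assumes "inj_on l {..k}"
  shows "divided_difference f k l = divdiff f (l ` {..k})"
  unfolding divided_difference_def divdiff_def
proof (subst sum.reindex[OF assms], rule sum.cong)
  fix i assume i: "i \<in> {..k}"
  have "l ` {..k} - {l i} = l ` ({..k} - {i})"
    using assms i by (auto simp: inj_on_def)
  moreover have "inj_on l ({..k} - {i})"
    using assms by (rule inj_on_subset) auto
  ultimately show "f (l i) / (\<Prod>j\<in>{..k} - {i}. l i - l j)
      = ((\<lambda>x. f x / (\<Prod>y\<in>l ` {..k} - {x}. x - y)) \<circ> l) i"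
    by (simp add: prod.reindex)
qed simp

lemma k_tone_on_iff_divdiff:
  "k_tone_on k I f \<longleftrightarrow> (\<forall>S. finite S \<and> card S = Suc k \<and> S \<subseteq> I \<longrightarrow> 0 \<le> divdiff f S)"
proof (intro iffI allI impI)
  fix S :: "real set"
  assume tone: "k_tone_on k I f" and S: "finite S \<and> card S = Suc k \<and> S \<subseteq> I"
  then obtain l where "bij_betw l {0..<Suc k} S"
    using ex_bij_betw_nat_finite[of S] by auto
  then have "inj_on l {..k}" "l ` {..k} = S"
    by (auto simp: bij_betw_def atLeast0LessThan lessThan_Suc_atMost)
  with tone S show "0 \<le> divdiff f S"
    using divided_difference_eq_divdiff[of l k f] unfolding k_tone_on_def by auto
next
  assume *: "\<forall>S. finite S \<and> card S = Suc k \<and> S \<subseteq> I \<longrightarrow> 0 \<le> divdiff f S"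
  show "k_tone_on k I f"
    unfolding k_tone_on_def using * by (simp add: divided_difference_eq_divdiff card_image)
qed

lemma k_tone_onD: "k_tone_on k I f \<Longrightarrow> finite S \<Longrightarrow> card S = Suc k \<Longrightarrow> S \<subseteq> I \<Longrightarrow> 0 \<le> divdiff f S"
  by (simp add: k_tone_on_iff_divdiff)

lemma divdiff_cong: "(\<And>x. x \<in> S \<Longrightarrow> f x = g x) \<Longrightarrow> divdiff f S = divdiff g S"
  by (simp add: divdiff_def)

lemma divdiff_diff: "divdiff (\<lambda>x. f x - g x) S = divdiff f S - divdiff g S"
  by (simp add: divdiff_def diff_divide_distrib sum_subtractf)

lemma divdiff_cmult: "divdiff (\<lambda>x. c * f x) S = c * divdiff f S"
  by (simp add: divdiff_def sum_distrib_left)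

lemma divdiff_translate: "divdiff f ((\<lambda>x. x + t) ` S) = divdiff (\<lambda>x. f (x + t)) S"
proof -
  have "(\<Prod>y\<in>(\<lambda>x. x + t) ` S - {x + t}. x + t - y) = (\<Prod>y\<in>S - {x}. x - y)" if "x \<in> S" for x
  proof -
    have "(\<lambda>x. x + t) ` S - {x + t} = (\<lambda>x. x + t) ` (S - {x})" by auto
    then show ?thesis by (simp add: prod.reindex)
  qed
  then show ?thesis by (simp add: divdiff_def sum.reindex)
qed

text \<open>The recursion for divided differences, read as a difference quotient in a single node: the two sets
  \<open>insert x S\<close> and \<open>insert y S\<close> differ by moving one node from \<open>y\<close> to \<open>x\<close>.\<close>

lemma divdiff_insert_diff:
  assumes "finite S" "x \<notin> S" "y \<notin> S" "x \<noteq> y"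
  shows "divdiff f (insert x S) - divdiff f (insert y S) = (x - y) * divdiff f (insert x (insert y S))"
proof -
  have ne: "z - x \<noteq> 0" "z - y \<noteq> 0" if "z \<in> S" for z using that assms by auto
  define P where "P z = (\<Prod>w\<in>S - {z}. z - w)" for z
  have P0: "P z \<noteq> 0" for z using assms(1) by (auto simp: P_def)
  have X: "divdiff f (insert x S) = f x / (\<Prod>w\<in>S. x - w) + (\<Sum>z\<in>S. f z / ((z - x) * P z))"
    if "x \<notin> S" for x
  proof -
    have "(\<Prod>w\<in>insert x S - {z}. z - w) = (z - x) * P z" if "z \<in> S" for z
    proof -
      have "insert x S - {z} = insert x (S - {z})" using that \<open>x \<notin> S\<close> by auto
      then show ?thesis using \<open>x \<notin> S\<close> assms(1) by (simp add: P_def)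
    qed
    moreover have "insert x S - {x} = S" using that by auto
    ultimately show ?thesis using that assms(1) by (simp add: divdiff_def)
  qed
  have XY: "divdiff f (insert x (insert y S)) = f x / ((x - y) * (\<Prod>w\<in>S. x - w))
     + f y / ((y - x) * (\<Prod>w\<in>S. y - w)) + (\<Sum>z\<in>S. f z / ((z - x) * ((z - y) * P z)))"
  proof -
    have "(\<Prod>w\<in>insert x (insert y S) - {z}. z - w) = (z - x) * ((z - y) * P z)" if "z \<in> S" for z
    proof -
      have "insert x (insert y S) - {z} = insert x (insert y (S - {z}))" using that assms by auto
      then show ?thesis using assms by (simp add: P_def)
    qed
    moreover have "insert x (insert y S) - {x} = insert y S" using assms by auto
    moreover have "insert x (insert y S) - {y} = insert x S" using assms by auto
    ultimately show ?thesis using assms by (simp add: divdiff_def)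
  qed
  have "(\<Sum>z\<in>S. f z / ((z - x) * P z)) - (\<Sum>z\<in>S. f z / ((z - y) * P z))
     = (x - y) * (\<Sum>z\<in>S. f z / ((z - x) * ((z - y) * P z)))"
    unfolding sum_subtractf[symmetric] sum_distrib_left
    by (rule sum.cong) (use ne P0 in \<open>auto simp: divide_simps\<close>, auto simp: algebra_simps)
  moreover have "(x - y) * (f x / ((x - y) * (\<Prod>w\<in>S. x - w))) = f x / (\<Prod>w\<in>S. x - w)"
    using assms by simp
  moreover have "(x - y) * (f y / ((y - x) * (\<Prod>w\<in>S. y - w))) = - (f y / (\<Prod>w\<in>S. y - w))"
  proof -
    have "(x - y) * (f y / ((y - x) * p)) = - (f y / p)" for p :: real
      using assms(4) by (cases "p = 0") (auto simp: divide_simps, auto simp: algebra_simps)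
    then show ?thesis .
  qed
  ultimately show ?thesis
    unfolding X[OF assms(2)] X[OF assms(3)] XY by (simp add: distrib_left)
qed

text \<open>Moving the nodes \<open>t i\<close> to \<open>r i\<close> one after the other turns the difference into a combination of
  divided differences of the next order. Three facts below rest on this: the sign of the next order
  gives monotonicity in the nodes, a bound on it gives a bound on the present order, and a common
  shift \<open>r i = t i + h\<close> gives the divided differences of the derivative.\<close>

lemma divdiff_diff_telescope:
  fixes r t :: "nat \<Rightarrow> real"
  assumes r: "inj_on r {..<m}" and t: "inj_on t {..<m}"
    and disj: "r ` {..<m} \<inter> t ` {..<m} = {}"
  shows "divdiff f (r ` {..<m}) - divdiff f (t ` {..<m})
       = (\<Sum>i<m. (r i - t i) * divdiff f (r ` {..i} \<union> t ` {i..<m}))"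
proof -
  define A where "A i = r ` {..<i} \<union> t ` {i..<m}" for i
  have step: "divdiff f (A (Suc i)) - divdiff f (A i) = (r i - t i) * divdiff f (r ` {..i} \<union> t ` {i..<m})"
    if i: "i < m" for i
  proof -
    define S where "S = r ` {..<i} \<union> t ` {Suc i..<m}"
    have ne: "r j \<noteq> t j'" if "j < m" "j' < m" for j j' using disj that by blast
    have "A (Suc i) = insert (r i) S"
      by (auto simp: A_def S_def lessThan_Suc)
    moreover have "A i = insert (t i) S"
    proof -
      have "{i..<m} = insert i {Suc i..<m}" using i by auto
      then show ?thesis by (auto simp: A_def S_def)
    qed
    moreover have "r ` {..i} \<union> t ` {i..<m} = insert (r i) (insert (t i) S)"
    proof -
      have "{..i} = insert i {..<i}" "{i..<m} = insert i {Suc i..<m}" using i by auto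
      then show ?thesis by (auto simp: S_def)
    qed
    moreover have "r i \<notin> S"
    proof -
      have "r i \<noteq> r j" if "j < i" for j using inj_onD[OF r, of i j] that i by auto
      then show ?thesis using i ne by (auto simp: S_def)
    qed
    moreover have "t i \<notin> S"
    proof -
      have "t i \<notin> t ` {Suc i..<m}"
        by (subst inj_on_image_mem_iff[OF t]) (use i in auto)
      moreover have "t i \<notin> r ` {..<i}"
      proof
        assume "t i \<in> r ` {..<i}"
        then obtain j where "j < i" "t i = r j" by blast
        then show False using ne[of j i] i by simp
      qed
      ultimately show ?thesis by (auto simp: S_def)
    qed
    moreover have "r i \<noteq> t i" "finite S" using ne i by (auto simp: S_def)
    ultimately show ?thesis using divdiff_insert_diff[of S "r i" "t i" f] by simp
  qed
  have "divdiff f (r ` {..<m}) - divdiff f (t ` {..<m}) = divdiff f (A m) - divdiff f (A 0)"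
    by (simp add: A_def atLeast0LessThan)
  also have "\<dots> = (\<Sum>i<m. divdiff f (A (Suc i)) - divdiff f (A i))"
    by (rule sum_lessThan_telescope[of "\<lambda>i. divdiff f (A i)" m, symmetric])
  finally show ?thesis using step by simp
qed

lemma card_replacement_set:
  fixes r t :: "nat \<Rightarrow> real"
  assumes "inj_on r {..<m}" "inj_on t {..<m}" "r ` {..<m} \<inter> t ` {..<m} = {}" "i < m"
  shows "card (r ` {..i} \<union> t ` {i..<m}) = Suc m"
proof -
  have "inj_on r {..i}" "inj_on t {i..<m}"
    by (rule inj_on_subset[OF assms(1)], use assms(4) in auto)
       (rule inj_on_subset[OF assms(2)], auto)
  moreover have "r ` {..i} \<inter> t ` {i..<m} = {}" 
  proof -
    have "r ` {..i} \<subseteq> r ` {..<m}" "t ` {i..<m} \<subseteq> t ` {..<m}" using assms(4) by auto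
    then show ?thesis using assms(3) by blast
  qed
  ultimately show ?thesis using assms(4) by (simp add: card_Un_disjoint card_image)
qed

lemma enumerate_set:
  assumes "finite (S :: real set)" "card S = m"
  obtains t where "inj_on t {..<m}" "t ` {..<m} = S"
  using ex_bij_betw_nat_finite[OF assms(1)] assms(2)
  by (auto simp: bij_betw_def atLeast0LessThan)

section \<open>Regularity of k-tone functions\<close>

definition locally_bounded_divdiffs :: "nat \<Rightarrow> real set \<Rightarrow> (real \<Rightarrow> real) \<Rightarrow> bool" where
  "locally_bounded_divdiffs m I f \<longleftrightarrow> (\<forall>c d. {c..d} \<subseteq> I \<longrightarrow>
     (\<exists>M. \<forall>S. finite S \<and> card S = Suc m \<and> S \<subseteq> {c..d} \<longrightarrow> \<bar>divdiff f S\<bar> \<le> M))"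

lemma open_interval_enlarge:
  assumes "open I" "is_interval I" "{c..d} \<subseteq> I" "c \<le> (d::real)"
  obtains c' d' where "c' < c" "d < d'" "{c'..d'} \<subseteq> I"
proof -
  obtain e1 where e1: "e1 > 0" "cball c e1 \<subseteq> I"
    using assms by (meson atLeastAtMost_iff open_contains_cball order_refl subsetD)
  obtain e2 where e2: "e2 > 0" "cball d e2 \<subseteq> I"
    using assms by (meson atLeastAtMost_iff open_contains_cball order_refl subsetD)
  have "c - e1 \<in> I" "d + e2 \<in> I" using e1 e2 by (auto simp: subset_iff dist_real_def)
  then have "{c - e1..d + e2} \<subseteq> I"
    using assms(2) by (meson atLeastAtMost_iff mem_is_interval_1_I subsetI)
  with e1 e2 show ?thesis by (intro that[of "c - e1" "d + e2"]) auto
qed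

lemma finite_subset_between:
  assumes "c < (d::real)"
  obtains R where "finite R" "card R = m" "R \<subseteq> {c<..<d}"
  using infinite_arbitrarily_large[of "{c<..<d}" m] assms by (auto simp: infinite_Ioo)

text \<open>For an \<open>(m + 1)\<close>-tone function, divided differences of order \<open>m\<close> grow when all nodes move to the
  right. Those with nodes in \<open>[c, d]\<close> therefore lie between the one for a fixed node set to the left
  of \<open>c\<close> and the one for a fixed node set to the right of \<open>d\<close>.\<close>

lemma k_tone_bounded_divdiffs:
  assumes I: "open I" "is_interval I" and tone: "k_tone_on (Suc m) I f"
  shows "locally_bounded_divdiffs m I f"
  unfolding locally_bounded_divdiffs_def
proof (intro allI impI)
  fix c d assume cd: "{c..d} \<subseteq> I"
  show "\<exists>M. \<forall>S. finite S \<and> card S = Suc m \<and> S \<subseteq> {c..d} \<longrightarrow> \<bar>divdiff f S\<bar> \<le> M"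
  proof (cases "c \<le> d")
    case False
    then show ?thesis by (auto simp: card_eq_0_iff)
  next
    case True
    obtain c' d' where cd': "c' < c" "d < d'" "{c'..d'} \<subseteq> I"
      using open_interval_enlarge[OF I cd True] by blast
    have le: "divdiff f T \<le> divdiff f R"
      if T: "finite T" "card T = Suc m" "T \<subseteq> {c'..d'}" and R: "finite R" "card R = Suc m" "R \<subseteq> {c'..d'}"
        and TR: "\<And>t r. t \<in> T \<Longrightarrow> r \<in> R \<Longrightarrow> t < r" for T R
    proof -
      obtain t where t: "inj_on t {..<Suc m}" "t ` {..<Suc m} = T"
        using enumerate_set[OF T(1,2)] .
      obtain r where r: "inj_on r {..<Suc m}" "r ` {..<Suc m} = R"
        using enumerate_set[OF R(1,2)] .
      have disj: "r ` {..<Suc m} \<inter> t ` {..<Suc m} = {}"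
        unfolding t(2) r(2) using TR by blast
      have "divdiff f R - divdiff f T
          = (\<Sum>i<Suc m. (r i - t i) * divdiff f (r ` {..i} \<union> t ` {i..<Suc m}))"
        using divdiff_diff_telescope[OF r(1) t(1) disj] t r by simp
      also have "\<dots> \<ge> 0"
      proof (intro sum_nonneg mult_nonneg_nonneg)
        fix i assume i: "i \<in> {..<Suc m}"
        show "0 \<le> r i - t i" using TR[of "t i" "r i"] i t r by auto
        have "r ` {..i} \<subseteq> R" "t ` {i..<Suc m} \<subseteq> T" using r(2) t(2) i by auto
        then show "0 \<le> divdiff f (r ` {..i} \<union> t ` {i..<Suc m})"
          using order_trans[OF T(3) cd'(3)] order_trans[OF R(3) cd'(3)] i by (intro k_tone_onD[OF tone] card_replacement_set r t disj) auto
      qed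
      finally show ?thesis by simp
    qed
    obtain L where L: "finite L" "card L = Suc m" "L \<subseteq> {c'<..<c}"
      using finite_subset_between[OF cd'(1)] .
    obtain R where R: "finite R" "card R = Suc m" "R \<subseteq> {d<..<d'}"
      using finite_subset_between[OF cd'(2)] .
    have "\<bar>divdiff f S\<bar> \<le> max \<bar>divdiff f L\<bar> \<bar>divdiff f R\<bar>"
      if S: "finite S \<and> card S = Suc m \<and> S \<subseteq> {c..d}" for S
    proof -
      have S': "finite S" "card S = Suc m" "S \<subseteq> {c'..d'}"
        using S cd' by (auto simp: subset_iff)
      have L': "L \<subseteq> {c'..d'}" and R': "R \<subseteq> {c'..d'}"
      proof -
        have "{c'<..<c} \<subseteq> {c'..d'}" "{d<..<d'} \<subseteq> {c'..d'}" using cd' True by auto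
        then show "L \<subseteq> {c'..d'}" "R \<subseteq> {c'..d'}" using L(3) R(3) by blast+
      qed
      have "divdiff f L \<le> divdiff f S"
      proof (rule le[OF L(1,2) L' S'])
        fix t r assume "t \<in> L" "r \<in> S"
        then have "t \<in> {c'<..<c}" "r \<in> {c..d}" using L S by blast+
        then show "t < r" by simp
      qed
      moreover have "divdiff f S \<le> divdiff f R"
      proof (rule le[OF S' R(1,2) R'])
        fix t r assume "t \<in> S" "r \<in> R"
        then have "r \<in> {d<..<d'}" "t \<in> {c..d}" using R S by blast+
        then show "t < r" by simp
      qed
      ultimately show ?thesis by linarith
    qed
    then show ?thesis by blast
  qed
qed

text \<open>Compare with a fixed node set beyond \<open>d\<close>: the telescoped difference has finitely many terms, each
  bounded by the diameter times the bound for the next order.\<close>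

lemma bounded_divdiffs_lower:
  assumes I: "open I" "is_interval I" and bd: "locally_bounded_divdiffs (Suc m) I f"
  shows "locally_bounded_divdiffs m I f"
  unfolding locally_bounded_divdiffs_def
proof (intro allI impI)
  fix c d assume cd: "{c..d} \<subseteq> I"
  show "\<exists>M. \<forall>S. finite S \<and> card S = Suc m \<and> S \<subseteq> {c..d} \<longrightarrow> \<bar>divdiff f S\<bar> \<le> M"
  proof (cases "c \<le> d")
    case False
    then show ?thesis by (auto simp: card_eq_0_iff)
  next
    case True
    obtain c' d' where cd': "c' < c" "d < d'" "{c'..d'} \<subseteq> I"
      using open_interval_enlarge[OF I cd True] by blast
    obtain M where M: "\<And>S. finite S \<Longrightarrow> card S = Suc (Suc m) \<Longrightarrow> S \<subseteq> {c'..d'} \<Longrightarrow> \<bar>divdiff f S\<bar> \<le> M"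
      using bd[unfolded locally_bounded_divdiffs_def, rule_format, OF cd'(3)] by blast
    obtain R where R: "finite R" "card R = Suc m" "R \<subseteq> {d<..<d'}"
      using finite_subset_between[OF cd'(2)] .
    obtain r where r: "inj_on r {..<Suc m}" "r ` {..<Suc m} = R"
      using enumerate_set[OF R(1,2)] .
    have R': "R \<subseteq> {c'..d'}"
      by (rule order_trans[OF R(3)]) (use cd' True in auto)
    have "\<bar>divdiff f S\<bar> \<le> \<bar>divdiff f R\<bar> + (\<Sum>i<Suc m. (d' - c') * M)"
      if S: "finite S \<and> card S = Suc m \<and> S \<subseteq> {c..d}" for S
    proof -
      have S': "S \<subseteq> {c'..d'}"
        by (rule order_trans[of _ "{c..d}"]) (use S cd' in auto)
      obtain t where t: "inj_on t {..<Suc m}" "t ` {..<Suc m} = S"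
        using enumerate_set[of S] S by blast
      have disj: "r ` {..<Suc m} \<inter> t ` {..<Suc m} = {}"
        unfolding t(2) r(2) using R S by (auto simp: subset_iff) (meson leD)
      have "divdiff f R - divdiff f S
          = (\<Sum>i<Suc m. (r i - t i) * divdiff f (r ` {..i} \<union> t ` {i..<Suc m}))"
        using divdiff_diff_telescope[OF r(1) t(1) disj] t r by simp
      also have "\<bar>\<dots>\<bar> \<le> (\<Sum>i<Suc m. (d' - c') * M)"
      proof (rule order_trans[OF sum_abs], rule sum_mono)
        fix i assume i: "i \<in> {..<Suc m}"
        have "r i \<in> R" "t i \<in> S" using r t i by auto
        then have "r i \<in> {c'..d'}" "t i \<in> {c'..d'}" using R' S' by blast+
        then have "\<bar>r i - t i\<bar> \<le> d' - c'" by auto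
        moreover have "r ` {..i} \<subseteq> R" "t ` {i..<Suc m} \<subseteq> S" using r(2) t(2) i by auto
        then have "\<bar>divdiff f (r ` {..i} \<union> t ` {i..<Suc m})\<bar> \<le> M"
          using R' S' i by (intro M card_replacement_set r t disj) auto
        ultimately show "\<bar>(r i - t i) * divdiff f (r ` {..i} \<union> t ` {i..<Suc m})\<bar> \<le> (d' - c') * M"
          unfolding abs_mult by (intro mult_mono) auto
      qed
      finally show ?thesis by linarith
    qed
    then show ?thesis by blast
  qed
qed

lemma k_tone_bounded_divdiffs_le:
  assumes I: "open I" "is_interval I" and tone: "k_tone_on k I f" and "m < k"
  shows "locally_bounded_divdiffs m I f"
proof -
  obtain j where k: "k = Suc j" using \<open>m < k\<close> by (cases k) auto
  have "m \<le> j" using k \<open>m < k\<close> by simp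
  then show ?thesis
  proof (induction rule: inc_induct)
    case base
    then show ?case using k_tone_bounded_divdiffs[OF I] tone k by simp
  next
    case (step n)
    then show ?case using bounded_divdiffs_lower[OF I] by simp
  qed
qed

lemma divdiff_pair: "x \<noteq> y \<Longrightarrow> divdiff f {x, y} = (f y - f x) / (y - x)"
proof -
  assume "x \<noteq> y"
  moreover from this have "{x, y} - {x} = {y}" "{x, y} - {y} = {x}" by auto
  ultimately show ?thesis
    by (simp add: divdiff_def divide_simps) (simp add: algebra_simps)
qed

lemma nbhd_Icc:
  assumes "open I" "is_interval I" "(x::real) \<in> I"
  obtains c d where "c < x" "x < d" "{c..d} \<subseteq> I"
  using open_interval_enlarge[of I x x] assms by auto

text \<open>Bounded difference quotients make \<open>f\<close> locally Lipschitz.\<close>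

lemma k_tone_continuous:
  assumes I: "open I" "is_interval I" and tone: "k_tone_on k I f" and "2 \<le> k"
  shows "continuous_on I f"
proof -
  have "isCont f x" if x: "x \<in> I" for x
  proof -
    obtain c d where cd: "c < x" "x < d" "{c..d} \<subseteq> I" using nbhd_Icc[OF I x] .
    have "locally_bounded_divdiffs 1 I f" using k_tone_bounded_divdiffs_le[OF I tone] \<open>2 \<le> k\<close> by simp
    then obtain M where M: "\<And>S. finite S \<Longrightarrow> card S = 2 \<Longrightarrow> S \<subseteq> {c..d} \<Longrightarrow> \<bar>divdiff f S\<bar> \<le> M"
      unfolding locally_bounded_divdiffs_def using cd(3) by (metis Suc_1 One_nat_def)
    have "\<bar>f y - f x\<bar> \<le> M * \<bar>y - x\<bar>" if "y \<in> {c<..<d}" for y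
    proof (cases "y = x")
      case False
      then have "\<bar>divdiff f {x, y}\<bar> \<le> M" using that cd by (intro M) auto
      then show ?thesis using False by (simp add: divdiff_pair divide_simps)
    qed simp
    then have "eventually (\<lambda>y. norm (f y - f x) \<le> M * \<bar>y - x\<bar>) (at x)"
      using cd by (intro eventually_mono[OF eventually_at_in_open[of "{c<..<d}" x]]) auto
    moreover have "((\<lambda>y. M * \<bar>y - x\<bar>) \<longlongrightarrow> 0) (at x)"
      by (auto intro!: tendsto_eq_intros)
    ultimately have "((\<lambda>y. f y - f x) \<longlongrightarrow> 0) (at x)" by (rule Lim_null_comparison)
    then show ?thesis unfolding isCont_def by (rule LIM_zero_cancel)
  qed
  then show ?thesis by (simp add: continuous_at_imp_continuous_on)
qed

text \<open>As divided differences of order 2 are bounded, the difference quotient \<open>z \<mapsto> [x, z]\<close> is Lipschitz on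
  a punctured neighbourhood of \<open>x\<close> and so extends continuously to \<open>x\<close>.\<close>

lemma k_tone_differentiable:
  assumes I: "open I" "is_interval I" and tone: "k_tone_on k I f" and "3 \<le> k" "x \<in> I"
  shows "f differentiable (at x)"
proof -
  obtain c d where cd: "c < x" "x < d" "{c..d} \<subseteq> I" using nbhd_Icc[OF I \<open>x \<in> I\<close>] .
  have "locally_bounded_divdiffs 2 I f" using k_tone_bounded_divdiffs_le[OF I tone] \<open>3 \<le> k\<close> by simp
  then obtain M where M: "\<And>S. finite S \<Longrightarrow> card S = 3 \<Longrightarrow> S \<subseteq> {c..d} \<Longrightarrow> \<bar>divdiff f S\<bar> \<le> M"
    using cd unfolding locally_bounded_divdiffs_def by (metis eval_nat_numeral(3))
  define q where "q = (\<lambda>z. (f z - f x) / (z - x))"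
  define X where "X = {c<..<d} - {x}"
  have "0 \<le> M"
  proof -
    have "\<bar>divdiff f {c, x, d}\<bar> \<le> M" using cd by (intro M) auto
    then show ?thesis by linarith
  qed
  have "lipschitz_on M X q"
  proof (rule lipschitz_onI)
    fix y z assume yz: "y \<in> X" "z \<in> X"
    show "dist (q y) (q z) \<le> M * dist y z"
    proof (cases "y = z")
      case False
      have "q y - q z = divdiff f {y, x} - divdiff f {z, x}"
        using yz by (simp add: q_def X_def divdiff_pair insert_commute)
      also have "\<dots> = (y - z) * divdiff f {y, z, x}"
        using yz False by (intro divdiff_insert_diff) (auto simp: X_def)
      finally have "dist (q y) (q z) = \<bar>y - z\<bar> * \<bar>divdiff f {y, z, x}\<bar>"
        by (simp add: dist_real_def abs_mult)
      moreover have "\<bar>divdiff f {y, z, x}\<bar> \<le> M"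
        using yz False cd by (intro M) (auto simp: X_def)
      ultimately show ?thesis 
        by (simp add: dist_real_def mult.commute[of M] mult_left_mono)
    qed simp
  qed fact
  then have "uniformly_continuous_on X q" by (rule lipschitz_on_uniformly_continuous)
  moreover have "x \<in> closure X"
  proof -
    have "x islimpt {c<..<d}" using cd by (intro interior_limit_point) auto
    then have "x islimpt X" unfolding X_def by (simp add: islimpt_punctured[symmetric])
    then show ?thesis by (simp add: closure_def)
  qed
  ultimately obtain l where "(q \<longlongrightarrow> l) (at x within X)"
    using uniformly_continuous_on_extension_at_closure by blast
  moreover have "at x within X = at x"
  proof -
    have "at x within X = at x within {c<..<d}" by (simp add: X_def at_within_def)
    also have "\<dots> = at x" by (rule at_within_open) (use cd in auto)
    finally show ?thesis .
  qed
  ultimately have "(f has_field_derivative l) (at x)"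
    by (simp add: has_field_derivative_iff q_def)
  then show ?thesis using real_differentiable_def by blast
qed

text \<open>The divided difference of \<open>x \<mapsto> (f (x + t) - f x) / t\<close> over \<open>S\<close> is \<open>1 / t\<close> times the change of that of
  \<open>f\<close> from \<open>S\<close> to \<open>S + t\<close>; telescoping writes the latter as \<open>t\<close> times a sum of nonnegative terms. Then
  \<open>t\<close> tends to 0.\<close>

lemma k_tone_deriv:
  assumes I: "open I" "is_interval I" and tone: "k_tone_on (Suc k) I f" and "2 \<le> k"
  shows "k_tone_on k I (deriv f)"
  unfolding k_tone_on_iff_divdiff
proof (intro allI impI, elim conjE)
  fix S assume S: "finite S" "card S = Suc k" "S \<subseteq> I"
  obtain s where s: "inj_on s {..<Suc k}" "s ` {..<Suc k} = S"
    using enumerate_set[OF S(1,2)] .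
  have lim: "((\<lambda>t. divdiff (\<lambda>x. (f (x + t) - f x) / t) S) \<longlongrightarrow> divdiff (deriv f) S) (at_right 0)"
    unfolding divdiff_def
  proof (intro tendsto_sum tendsto_divide tendsto_const)
    fix x assume "x \<in> S"
    then have "f differentiable (at x)"
      using S \<open>2 \<le> k\<close> by (intro k_tone_differentiable[OF I tone]) auto
    then have "(f has_field_derivative deriv f x) (at x)"
      using DERIV_deriv_iff_real_differentiable by blast
    then have "((\<lambda>t. (f (x + t) - f x) / t) \<longlongrightarrow> deriv f x) (at 0)"
      by (simp add: DERIV_def)
    then show "((\<lambda>t. (f (x + t) - f x) / t) \<longlongrightarrow> deriv f x) (at_right 0)"
      by (rule filterlim_mono) (auto simp: at_le)
    show "(\<Prod>y\<in>S - {x}. x - y) \<noteq> 0" using S by auto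
  qed
  have "eventually (\<lambda>t. \<forall>x\<in>S. x + t \<in> I) (at_right 0)"
  proof -
    have "eventually (\<lambda>t. x + t \<in> I) (at_right 0)" if "x \<in> S" for x
    proof -
      have "((\<lambda>t. x + t) \<longlongrightarrow> x + 0) (at_right 0)" by (intro tendsto_intros)
      then show ?thesis using topological_tendstoD[of _ "x + 0" _ I] I S that by auto
    qed
    then show ?thesis using S(1) by (simp add: eventually_ball_finite)
  qed
  \<comment> \<open>Telescoping needs \<open>S\<close> and \<open>S + t\<close> disjoint, which holds once \<open>t\<close> avoids the differences of nodes.\<close>
  moreover have "eventually (\<lambda>t. \<forall>p\<in>S \<times> S. t \<noteq> fst p - snd p) (at_right 0)"
  proof -
    have "eventually (\<lambda>t. t \<noteq> fst p - snd p) (at_right (0::real))" if "p \<in> S \<times> S" for p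
    proof (cases "fst p - snd p > 0")
      case True
      then have "eventually (\<lambda>t. t < fst p - snd p) (at_right (0::real))"
        by (intro order_tendstoD(2)[OF tendsto_ident_at])
      then show ?thesis by eventually_elim auto
    next
      case False
      have "eventually (\<lambda>t. t > 0) (at_right (0::real))" by (rule eventually_at_right_less)
      then show ?thesis by eventually_elim (use False in auto)
    qed
    then show ?thesis using S(1) by (intro eventually_ball_finite) auto
  qed
  moreover have "eventually (\<lambda>t. t > 0) (at_right (0::real))" by (rule eventually_at_right_less)
  ultimately have "eventually (\<lambda>t. 0 \<le> divdiff (\<lambda>x. (f (x + t) - f x) / t) S) (at_right 0)"
  proof eventually_elim
    case (elim t)
    define r where "r i = s i + t" for i
    have rS: "r ` {..<Suc k} = (\<lambda>x. x + t) ` S" unfolding s(2)[symmetric] r_def by (simp add: image_image)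
    have r: "inj_on r {..<Suc k}" using s(1) by (auto simp: inj_on_def r_def)
    have disj: "r ` {..<Suc k} \<inter> s ` {..<Suc k} = {}"
      unfolding rS s(2) using elim(2) by fastforce
    have "divdiff (\<lambda>x. (f (x + t) - f x) / t) S = (divdiff f (r ` {..<Suc k}) - divdiff f S) / t"
      unfolding rS divdiff_translate divdiff_diff[symmetric] using divdiff_cmult[of "1 / t"] by simp
    also have "\<dots> = (\<Sum>i<Suc k. (r i - s i) * divdiff f (r ` {..i} \<union> s ` {i..<Suc k})) / t"
      using divdiff_diff_telescope[OF r s(1) disj] s(2) by simp
    also have "\<dots> \<ge> 0"
    proof (intro divide_nonneg_pos sum_nonneg mult_nonneg_nonneg elim(3))
      fix i assume i: "i \<in> {..<Suc k}"
      show "0 \<le> r i - s i" using elim(3) by (simp add: r_def)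
      have "r ` {..i} \<subseteq> r ` {..<Suc k}" "s ` {i..<Suc k} \<subseteq> S" using s(2) i by auto
      moreover have "r ` {..<Suc k} \<subseteq> I" unfolding rS using elim(1) by auto
      ultimately show "0 \<le> divdiff f (r ` {..i} \<union> s ` {i..<Suc k})"
        using S i by (intro k_tone_onD[OF tone] card_replacement_set r s disj) auto
    qed
    finally show ?case .
  qed
  with lim show "0 \<le> divdiff (deriv f) S"
    by (intro tendsto_lowerbound[OF lim]) auto
qed

lemma k_tone_imp_C_k:
  assumes I: "open I" "is_interval I" and tone: "k_tone_on (k + 2) I f"
  shows "C_k_on k I f"
  using tone
proof (induction k arbitrary: f)
  case 0
  then show ?case using k_tone_continuous[OF I] by (simp add: C_k_on_def)
next
  case (Suc k)
  have "k_tone_on (k + 2) I (deriv f)" using k_tone_deriv[OF I, of "k + 2" f] Suc.prems by simp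
  then have "C_k_on k I (deriv f)" by (rule Suc.IH)
  moreover have "\<forall>x\<in>I. f differentiable (at x)"
    using k_tone_differentiable[OF I Suc.prems] by simp
  ultimately show ?case
    unfolding C_k_on_def by (auto simp: less_Suc_eq_0_disj funpow_Suc_right simp del: funpow.simps(2))
qed

section \<open>Divided differences and derivatives\<close>

text \<open>The induction removes the largest zero of \<open>g\<close>. Keeping the zeros of \<open>g'\<close> found so far below
  \<open>Max Z\<close> ensures that the zero between the two largest points is new.\<close>

lemma Rolle_iterated_step:
  assumes I: "is_interval I"
    and der: "\<And>x. x \<in> I \<Longrightarrow> (g has_real_derivative g' x) (at x)"
    and Z: "finite Z" "card Z = Suc m" "Z \<subseteq> I" "\<And>z. z \<in> Z \<Longrightarrow> g z = 0"
  obtains Z' where "finite Z'" "card Z' = m" "Z' \<subseteq> I" "\<And>z. z \<in> Z' \<Longrightarrow> g' z = 0"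
proof -
  have "\<exists>Z'. finite Z' \<and> card Z' = m \<and> Z' \<subseteq> {z \<in> I. z < Max Z \<and> g' z = 0}"
    using Z
  proof (induction m arbitrary: Z)
    case 0
    then show ?case by (intro exI[of _ "{}"]) auto
  next
    case (Suc m)
    define W where "W = Z - {Max Z}"
    have MZ: "Max Z \<in> Z" using Suc.prems by (intro Max_in) auto
    have W: "finite W" "card W = Suc m" "W \<subseteq> I" "\<And>z. z \<in> W \<Longrightarrow> g z = 0"
      using Suc.prems MZ by (auto simp: W_def)
    obtain W' where W': "finite W'" "card W' = m" "W' \<subseteq> {z \<in> I. z < Max W \<and> g' z = 0}"
      using Suc.IH[OF W] by blast
    have MW: "Max W \<in> W" using W by (intro Max_in) auto
    have lt: "Max W < Max Z"
      using MW Suc.prems(1) by (auto simp: W_def order_less_le)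
    have sub: "{Max W..Max Z} \<subseteq> I"
      using I MW MZ W(3) Suc.prems(3) by (meson atLeastAtMost_iff mem_is_interval_1_I subset_iff)
    have "\<exists>z. Max W < z \<and> z < Max Z \<and> (g has_real_derivative 0) (at z)"
    proof (rule Rolle[OF lt])
      show "g (Max W) = g (Max Z)" using W(4) MW Suc.prems(4) MZ by simp
      show "continuous_on {Max W..Max Z} g"
        using der sub by (meson DERIV_isCont continuous_at_imp_continuous_on subsetD)
      fix z assume "Max W < z" "z < Max Z"
      then have "z \<in> I" using sub by auto
      then show "g differentiable (at z)" using der real_differentiable_def by blast
    qed
    then obtain z where z: "Max W < z" "z < Max Z" "(g has_real_derivative 0) (at z)" by blast
    then have "z \<in> I" using sub by auto
    then have "g' z = 0" using z(3) der[of z] DERIV_unique by blast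
    moreover have "z \<notin> W'" using W' z by auto
    ultimately show ?case
      using W' z \<open>z \<in> I\<close> lt by (intro exI[of _ "insert z W'"]) auto
  qed
  then show ?thesis using that by auto
qed

lemma Rolle_iterated:
  assumes I: "is_interval I"
    and der: "\<And>j x. j < k \<Longrightarrow> x \<in> I \<Longrightarrow> (G j has_real_derivative G (Suc j) x) (at x)"
    and Z: "finite Z" "card Z = Suc k" "Z \<subseteq> I" "\<And>z. z \<in> Z \<Longrightarrow> G 0 z = 0"
  obtains z where "z \<in> I" "G k z = 0"
proof -
  have "\<exists>Z. finite Z \<and> card Z = Suc (k - j) \<and> Z \<subseteq> I \<and> (\<forall>z\<in>Z. G j z = 0)" if "j \<le> k" for j
    using that
  proof (induction j)
    case 0
    then show ?case using Z by auto
  next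
    case (Suc j)
    then obtain Y where Y: "finite Y" "card Y = Suc (k - j)" "Y \<subseteq> I" "\<forall>z\<in>Y. G j z = 0" by auto
    obtain Y' where "finite Y'" "card Y' = k - j" "Y' \<subseteq> I" "\<And>z. z \<in> Y' \<Longrightarrow> G (Suc j) z = 0"
      using Rolle_iterated_step[OF I, of "G j" "G (Suc j)" Y "k - j"] der[of j] Y Suc.prems by auto
    then show ?case using Suc.prems by (auto simp: Suc_diff_Suc intro!: exI[of _ Y'])
  qed
  from this[of k] obtain Y where Y: "card Y = 1" "Y \<subseteq> I" "\<forall>z\<in>Y. G k z = 0" by auto
  then show ?thesis using that by (auto simp: card_1_singleton_iff)
qed

text \<open>Up to its normalizing factor each Lagrange basis polynomial is monic of degree \<open>k\<close>, so the leading
  coefficients add up to the divided difference.\<close>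

lemma interpolation_poly:
  fixes f :: "real \<Rightarrow> real"
  assumes S: "finite S" "card S = Suc k"
  obtains p where "\<And>x. x \<in> S \<Longrightarrow> poly p x = f x" "degree p \<le> k" "poly.coeff p k = divdiff f S"
proof -
  define q where "q s = (\<Prod>y\<in>S - {s}. [:- y, 1:])" for s :: real
  define p where "p = (\<Sum>s\<in>S. Polynomial.smult (f s / (\<Prod>y\<in>S - {s}. s - y)) (q s))"
  have deg: "degree (q s) = k" if "s \<in> S" for s
    using S that by (simp add: q_def degree_prod_eq_sum_degree)
  have lead: "poly.coeff (q s) k = 1" if "s \<in> S" for s
  proof -
    have "lead_coeff (q s) = 1" unfolding q_def by (simp add: lead_coeff_prod)
    then show ?thesis using deg[OF that] by simp
  qed
  have q: "poly (q s) x = (\<Prod>y\<in>S - {s}. x - y)" for s x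
    by (simp add: q_def poly_prod)
  show ?thesis
  proof
    fix x assume x: "x \<in> S"
    have "poly (q s) x = 0" if "s \<in> S - {x}" for s
      using S x that by (auto simp: q)
    then have "(\<Sum>s\<in>S - {x}. f s / (\<Prod>y\<in>S - {s}. s - y) * poly (q s) x) = 0"
      by (intro sum.neutral) auto
    then show "poly p x = f x"
      using S(1) x by (simp add: p_def poly_sum sum.remove[OF S(1) x] q)
  next
    show "degree p \<le> k" unfolding p_def
      using deg by (intro degree_sum_le S(1)) (metis degree_smult_le order_trans order_eq_refl)
    show "poly.coeff p k = divdiff f S"
      by (simp add: p_def coeff_sum lead divdiff_def)
  qed
qed

text \<open>The mean value theorem for divided differences: \<open>G 0\<close> minus its interpolation polynomial has
  \<open>k + 1\<close> zeros, so its \<open>k\<close>-th derivative, \<open>G k\<close> minus \<open>k!\<close> times the divided difference, has one.\<close>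

lemma divdiff_nonneg_of_deriv_nonneg:
  assumes I: "is_interval I"
    and der: "\<And>j x. j < k \<Longrightarrow> x \<in> I \<Longrightarrow> (G j has_real_derivative G (Suc j) x) (at x)"
    and nonneg: "\<And>x. x \<in> I \<Longrightarrow> 0 \<le> G k x"
    and S: "finite S" "card S = Suc k" "S \<subseteq> I"
  shows "0 \<le> divdiff (G 0) S"
proof -
  obtain p where p: "\<And>x. x \<in> S \<Longrightarrow> poly p x = G 0 x" "degree p \<le> k" "poly.coeff p k = divdiff (G 0) S"
    using interpolation_poly[OF S(1,2), of "G 0"] by blast
  define H where "H j x = G j x - poly ((pderiv ^^ j) p) x" for j x
  have "(H j has_real_derivative H (Suc j) x) (at x)" if "j < k" "x \<in> I" for j x
    unfolding H_def using der[OF that] by (auto intro!: derivative_eq_intros)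
  then obtain z where z: "z \<in> I" "H k z = 0"
    using Rolle_iterated[OF I, of k H S] S p(1) by (auto simp: H_def)
  have "degree ((pderiv ^^ k) p) = 0" using p(2) by (simp add: degree_higher_pderiv)
  then have "poly ((pderiv ^^ k) p) z = poly.coeff ((pderiv ^^ k) p) 0"
    by (metis degree_0_id poly_pCons poly_0 mult_zero_right add_0_right)
  also have "\<dots> = fact k * divdiff (G 0) S"
    by (simp add: coeff_higher_pderiv p(3) pochhammer_fact)
  finally have "fact k * divdiff (G 0) S = G k z" using z(2) by (simp add: H_def)
  then show ?thesis using nonneg[OF z(1)]
    by (metis fact_gt_zero zero_le_mult_iff not_less)
qed

section \<open>Continuous functions with a nonnegative stencil\<close>

lemma iterated_antiderivative:
  assumes "a < b" "continuous_on (einterval a b) f"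
  shows "\<exists>G. G k = f \<and>
    (\<forall>j<k. \<forall>x\<in>einterval a b. (G j has_real_derivative G (Suc j) x) (at x))"
  using assms(2)
proof (induction k arbitrary: f)
  case 0
  show ?case by (intro exI[of _ "\<lambda>_. f"]) simp
next
  case (Suc k)
  have "\<exists>F. \<forall>x::real. a < x \<longrightarrow> x < b \<longrightarrow> (F has_vector_derivative f x) (at x)"
    using Suc.prems by (intro einterval_antiderivative assms(1))
      (simp add: continuous_on_eq_continuous_at einterval_iff)
  then obtain F where F: "\<And>x. x \<in> einterval a b \<Longrightarrow> (F has_real_derivative f x) (at x)"
    by (auto simp: einterval_iff has_real_derivative_iff_has_vector_derivative)
  then have "continuous_on (einterval a b) F"
    by (meson DERIV_isCont continuous_at_imp_continuous_on)
  from Suc.IH[OF this] obtain G where G: "G k = F"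
      "\<And>j x. j < k \<Longrightarrow> x \<in> einterval a b \<Longrightarrow> (G j has_real_derivative G (Suc j) x) (at x)"
    by blast
  show ?case
    using G F by (intro exI[of _ "G(Suc k := f)"]) (auto simp: less_Suc_eq)
qed

text \<open>A finite-difference inequality with one fixed pattern of nodes and coefficients, at every base point
  \<open>x\<close> and every scale \<open>e\<close>. If the pattern annihilates the monomials of degree below \<open>k\<close> and is positive on the one of degree \<open>k\<close>, then for small \<open>e\<close> it
  approximates a positive multiple of \<open>e ^ k\<close> times the \<open>k\<close>-th derivative.\<close>

definition stencil_nonneg_on :: "'i set \<Rightarrow> ('i \<Rightarrow> real) \<Rightarrow> ('i \<Rightarrow> real) \<Rightarrow> real set \<Rightarrow> (real \<Rightarrow> real) \<Rightarrow> bool" where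
  "stencil_nonneg_on K c p I f \<longleftrightarrow>
     (\<forall>x e. 0 < e \<and> (\<forall>i\<in>K. x + e * p i \<in> I) \<longrightarrow> 0 \<le> (\<Sum>i\<in>K. c i * f (x + e * p i)))"

text \<open>Taylor expansion at \<open>x\<close>: the vanishing moments remove all terms of order below \<open>k\<close>.\<close>

lemma stencil_limit:
  fixes c p :: "'i \<Rightarrow> real"
  assumes K: "finite K" and k: "0 < k"
    and zero: "\<And>m. m < k \<Longrightarrow> (\<Sum>i\<in>K. c i * p i ^ m) = 0"
    and I: "open I" and x: "x \<in> I"
    and der: "\<And>j x. j < k \<Longrightarrow> x \<in> I \<Longrightarrow> (G j has_real_derivative G (Suc j) x) (at x)"
    and cont: "continuous_on I (G k)"
  shows "((\<lambda>e. (\<Sum>i\<in>K. c i * G 0 (x + e * p i)) / e ^ k) \<longlongrightarrow>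
     (\<Sum>i\<in>K. c i * p i ^ k) * G k x / fact k) (at_right 0)"
proof -
  \<comment> \<open>\<open>\<phi> j\<close> is the \<open>j\<close>-th derivative of the stencil of \<open>G 0\<close> at \<open>x\<close> as a function of the scale.\<close>
  define \<phi> where "\<phi> j e = (\<Sum>i\<in>K. c i * p i ^ j * G j (x + e * p i))" for j e
  have near: "\<exists>d>0. \<forall>e. \<bar>e\<bar> < d \<longrightarrow> (\<forall>i\<in>K. x + e * p i \<in> I)"
  proof -
    have "eventually (\<lambda>e. x + e * p i \<in> I) (nhds (0::real))" for i
    proof -
      have "((\<lambda>e. x + e * p i) \<longlongrightarrow> x + 0 * p i) (nhds 0)"
        by (intro tendsto_intros) (simp add: filterlim_def)
      then show ?thesis using topological_tendstoD[of _ _ "nhds 0" I] I x by auto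
    qed
    then have "eventually (\<lambda>e. \<forall>i\<in>K. x + e * p i \<in> I) (nhds (0::real))"
      using K by (intro eventually_ball_finite) auto
    then show ?thesis by (auto simp: eventually_nhds_metric dist_real_def)
  qed
  then obtain d where d: "d > 0" "\<And>e i. \<bar>e\<bar> < d \<Longrightarrow> i \<in> K \<Longrightarrow> x + e * p i \<in> I" by blast
  have D: "(\<phi> j has_real_derivative \<phi> (Suc j) e) (at e)" if "j < k" "\<bar>e\<bar> < d" for j e
  proof -
    have "((\<lambda>e. G j (x + e * p i)) has_real_derivative G (Suc j) (x + e * p i) * p i) (at e)"
      if i: "i \<in> K" for i
      by (rule DERIV_chain2[OF der]) (use \<open>j < k\<close> d(2)[OF \<open>\<bar>e\<bar> < d\<close> i] in \<open>auto intro!: derivative_eq_intros\<close>)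
    then show ?thesis unfolding \<phi>_def
      by (auto intro!: derivative_eq_intros simp: algebra_simps)
  qed
  have \<phi>0: "\<phi> j 0 = (\<Sum>i\<in>K. c i * p i ^ j) * G j x" for j
    by (simp add: \<phi>_def sum_distrib_right)
  have mac: "\<exists>t. 0 < t \<and> t < e \<and> \<phi> 0 e = \<phi> k t / fact k * e ^ k" if e: "0 < e" "e < d" for e
  proof -
    have "\<exists>t>0. t < e \<and> \<phi> 0 e = (\<Sum>m<k. \<phi> m 0 / fact m * e ^ m) + \<phi> k t / fact k * e ^ k"
      using D e k by (intro Maclaurin) auto
    moreover have "(\<Sum>m<k. \<phi> m 0 / fact m * e ^ m) = 0"
      by (intro sum.neutral) (simp add: \<phi>0 zero)
    ultimately show ?thesis by auto
  qed
  have "isCont (\<phi> k) 0"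
  proof -
    have "isCont (\<lambda>e. G k (x + e * p i)) 0" for i
    proof -
      have "isCont (G k) x" using cont I x by (simp add: continuous_on_eq_continuous_at)
      then have "isCont (G k) (x + 0 * p i)" by simp
      then show ?thesis by (rule isCont_o2[rotated]) (intro continuous_intros)
    qed
    then show ?thesis unfolding \<phi>_def by (intro continuous_intros)
  qed
  then have lim: "(\<phi> k \<longlongrightarrow> \<phi> k 0) (at 0)" by (simp add: isCont_def)
  have "((\<lambda>e. \<phi> 0 e / e ^ k) \<longlongrightarrow> \<phi> k 0 / fact k) (at_right 0)"
  proof (rule tendstoI)
    fix \<epsilon> :: real assume "\<epsilon> > 0"
    have "((\<lambda>t. \<phi> k t / fact k) \<longlongrightarrow> \<phi> k 0 / fact k) (at 0)"
      by (intro tendsto_intros lim) auto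
    then have "eventually (\<lambda>t. dist (\<phi> k t / fact k) (\<phi> k 0 / fact k) < \<epsilon>) (at 0)"
      using \<open>\<epsilon> > 0\<close> by (rule tendstoD)
    then obtain d' where d': "d' > 0"
      "\<And>t. t \<noteq> 0 \<Longrightarrow> \<bar>t\<bar> < d' \<Longrightarrow> dist (\<phi> k t / fact k) (\<phi> k 0 / fact k) < \<epsilon>"
      by (auto simp: eventually_at dist_real_def)
    have "eventually (\<lambda>e. 0 < e \<and> e < min d d') (at_right 0)"
      using d(1) d'(1) by (intro eventually_at_rightI[of 0 "min d d'"]) auto
    then show "eventually (\<lambda>e. dist (\<phi> 0 e / e ^ k) (\<phi> k 0 / fact k) < \<epsilon>) (at_right 0)"
    proof eventually_elim
      case (elim e)
      obtain t where t: "0 < t" "t < e" "\<phi> 0 e = \<phi> k t / fact k * e ^ k" using mac[of e] elim by auto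
      then show ?case using d'(2)[of t] elim by simp
    qed
  qed
  then show ?thesis unfolding \<phi>0 by (simp add: \<phi>_def)
qed

text \<open>A \<open>k\<close>-fold antiderivative of \<open>f\<close> does the smoothing. Let \<open>G\<close> be one, and let \<open>\<psi> e x\<close> be its stencil at
  base point \<open>x\<close> and scale \<open>e\<close>. As a function of \<open>x\<close>, its \<open>k\<close>-th derivative is the stencil of \<open>f\<close>,
  hence nonnegative, so its divided differences of order \<open>k\<close> are nonnegative. On the other hand
  \<open>\<psi> e x / e ^ k\<close> tends to a positive multiple of \<open>f x\<close>. Thus \<open>f\<close> is a pointwise limit of functions
  with nonnegative divided differences.\<close>

lemma stencil_imp_k_tone:
  fixes c p :: "'i \<Rightarrow> real"
  assumes K: "finite K" and k: "0 < k"
    and zero: "\<And>m. m < k \<Longrightarrow> (\<Sum>i\<in>K. c i * p i ^ m) = 0"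
    and pos: "0 < (\<Sum>i\<in>K. c i * p i ^ k)"
    and "a < b" and cont: "continuous_on (einterval a b) f"
    and st: "stencil_nonneg_on K c p (einterval a b) f"
  shows "k_tone_on k (einterval a b) f"
  unfolding k_tone_on_iff_divdiff
proof (intro allI impI, elim conjE)
  fix S assume S: "finite S" "card S = Suc k" "S \<subseteq> einterval a b"
  let ?I = "einterval a b"
  obtain G where G: "G k = f"
      "\<And>j x. j < k \<Longrightarrow> x \<in> ?I \<Longrightarrow> (G j has_real_derivative G (Suc j) x) (at x)"
    using iterated_antiderivative[OF \<open>a < b\<close> cont, of k] by blast
  define \<kappa> where "\<kappa> = (\<Sum>i\<in>K. c i * p i ^ k) / fact k"
  have \<kappa>: "\<kappa> > 0" using pos by (simp add: \<kappa>_def)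
  define \<psi> where "\<psi> e j x = (\<Sum>i\<in>K. c i * G j (x + e * p i))" for e j x
  define J where "J = {Min S..Max S}"
  have Sne: "S \<noteq> {}" using S by auto
  have mm: "Min S \<in> ?I" "Max S \<in> ?I" using S Sne by (meson Min_in Max_in subsetD)+
  have SJ: "S \<subseteq> J" using S(1) by (auto simp: J_def)
  have "eventually (\<lambda>e. \<forall>i\<in>K. Min S + e * p i \<in> ?I \<and> Max S + e * p i \<in> ?I) (at_right 0)"
  proof -
    have "eventually (\<lambda>e. y + e * p i \<in> ?I) (at_right (0::real))" if "y \<in> ?I" for i y
    proof -
      have "((\<lambda>e. y + e * p i) \<longlongrightarrow> y + 0 * p i) (at_right 0)" by (intro tendsto_intros)
      then show ?thesis using topological_tendstoD[of _ _ "at_right 0" ?I] that by auto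
    qed
    then show ?thesis using K mm by (intro eventually_ball_finite ballI eventually_conj) auto
  qed
  moreover have "eventually (\<lambda>e. e > 0) (at_right (0::real))" by (rule eventually_at_right_less)
  ultimately have ev: "eventually (\<lambda>e. 0 \<le> divdiff (\<lambda>x. \<psi> e 0 x / e ^ k) S) (at_right 0)"
  proof eventually_elim
    case (elim e)
    have JI: "x + e * p i \<in> ?I" if "i \<in> K" "x \<in> J" for i x
    proof -
      have "Min S + e * p i \<in> ?I" "Max S + e * p i \<in> ?I" using elim(1) that by auto
      moreover have "Min S + e * p i \<le> x + e * p i" "x + e * p i \<le> Max S + e * p i"
        using that by (auto simp: J_def)
      ultimately show ?thesis
        unfolding einterval_iff by (meson ereal_less_eq(3) less_le_trans le_less_trans)
    qed
    have "0 \<le> divdiff (\<psi> e 0) S"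
    proof (rule divdiff_nonneg_of_deriv_nonneg[of J k "\<psi> e"])
      show "is_interval J" by (simp add: J_def is_interval_cc)
      show "(\<psi> e j has_real_derivative \<psi> e (Suc j) x) (at x)" if "j < k" "x \<in> J" for j x
      proof -
        have "((\<lambda>x. G j (x + e * p i)) has_real_derivative G (Suc j) (x + e * p i)) (at x)"
          if i: "i \<in> K" for i
          using G(2)[OF \<open>j < k\<close> JI[OF i \<open>x \<in> J\<close>]] by (simp add: DERIV_shift)
        then show ?thesis unfolding \<psi>_def by (intro DERIV_sum DERIV_cmult)
      qed
      show "0 \<le> \<psi> e k x" if "x \<in> J" for x
        using st elim(2) JI[OF _ that] unfolding stencil_nonneg_on_def \<psi>_def G(1) by blast
    qed (use S SJ in auto)
    moreover have "divdiff (\<lambda>x. \<psi> e 0 x / e ^ k) S = divdiff (\<psi> e 0) S / e ^ k"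
      using divdiff_cmult[of "1 / e ^ k" "\<psi> e 0" S] by simp
    ultimately show ?case using elim(2) by simp
  qed
  have "((\<lambda>e. divdiff (\<lambda>x. \<psi> e 0 x / e ^ k) S) \<longlongrightarrow> divdiff (\<lambda>x. \<kappa> * f x) S) (at_right 0)"
    unfolding divdiff_def
  proof (intro tendsto_sum tendsto_divide tendsto_const)
    fix x assume "x \<in> S"
    then show "((\<lambda>e. \<psi> e 0 x / e ^ k) \<longlongrightarrow> \<kappa> * f x) (at_right 0)"
      using stencil_limit[OF K k zero, of "?I" x G] S G cont by (auto simp: \<psi>_def \<kappa>_def)
    show "(\<Prod>y\<in>S - {x}. x - y) \<noteq> 0" using S by auto
  qed
  then have "0 \<le> divdiff (\<lambda>x. \<kappa> * f x) S"
    using ev by (intro tendsto_lowerbound) auto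
  then show "0 \<le> divdiff f S" using \<kappa> by (simp add: divdiff_cmult zero_le_mult_iff)
qed

section \<open>Monotone functions with a nonnegative stencil\<close>

text \<open>The infimum over the points to the right of \<open>x\<close> is the right limit of \<open>f\<close> at \<open>x\<close>; the three claims
  are the form in which this is used.\<close>

lemma mono_right_limit:
  fixes f :: "real \<Rightarrow> real"
  assumes I: "open I" "is_interval I" and mono: "mono_on I f" and x: "x \<in> I"
  defines "l \<equiv> Inf (f ` (I \<inter> {x<..}))"
  shows "f x \<le> l" "\<And>y. y \<in> I \<Longrightarrow> x < y \<Longrightarrow> l \<le> f y"
    "\<And>e. e > 0 \<Longrightarrow> \<exists>y\<in>I. x < y \<and> f y < l + e"
proof -
  obtain c d where cd: "c < x" "x < d" "{c..d} \<subseteq> I" using nbhd_Icc[OF I x] .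
  then have "d \<in> I \<inter> {x<..}" by auto
  then have ne: "f ` (I \<inter> {x<..}) \<noteq> {}" by blast
  have lb: "f x \<le> z" if "z \<in> f ` (I \<inter> {x<..})" for z
    using that mono_onD[OF mono x] by (auto simp: less_imp_le)
  then have bdd: "bdd_below (f ` (I \<inter> {x<..}))" by (rule bdd_belowI)
  show "f x \<le> l" unfolding l_def by (rule cInf_greatest[OF ne lb])
  show "l \<le> f y" if "y \<in> I" "x < y" for y
    unfolding l_def by (rule cInf_lower[OF _ bdd]) (use that in auto)
  show "\<exists>y\<in>I. x < y \<and> f y < l + e" if "e > 0" for e
    using cInf_lessD[OF ne, of "l + e"] that by (auto simp: l_def)
qed

text \<open>On \<open>{x<..x + h}\<close> the values of \<open>f\<close> are close to the right limit \<open>l\<close>; the value at \<open>x\<close> itself may be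
  smaller, but a single point does not change the integral.\<close>

lemma steklov_mean_tendsto:
  fixes f :: "real \<Rightarrow> real"
  assumes I: "is_interval I" and mono: "mono_on I f" and x: "x \<in> I"
    and lower: "\<And>y. y \<in> I \<Longrightarrow> x < y \<Longrightarrow> l \<le> f y"
    and upper: "\<And>e. e > 0 \<Longrightarrow> \<exists>y\<in>I. x < y \<and> f y < l + e"
  shows "((\<lambda>h. integral {x..x + h} f / h) \<longlongrightarrow> l) (at_right 0)"
proof (rule tendstoI)
  fix e :: real assume "e > 0"
  then obtain y where y: "y \<in> I" "x < y" "f y < l + e / 2" using upper[of "e / 2"] by auto
  have sub: "{x..y} \<subseteq> I" using I x y by (meson atLeastAtMost_iff mem_is_interval_1_I subsetI)
  have "eventually (\<lambda>h. 0 < h \<and> h < y - x) (at_right 0)"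
    using y by (intro eventually_at_rightI[of 0 "y - x"]) auto
  then show "eventually (\<lambda>h. dist (integral {x..x + h} f / h) l < e) (at_right 0)"
  proof eventually_elim
    case (elim h)
    define f' where "f' = f(x := l)"
    have sub': "{x..x + h} \<subseteq> {x..y}" using elim by auto
    have "f integrable_on {x..x + h}"
      by (rule integrable_on_mono_on, rule mono_on_subset[OF mono order_trans[OF sub' sub]])
    then have int: "f' integrable_on {x..x + h}"
      by (rule integrable_spike[of _ _ "{x}"]) (auto simp: f'_def)
    have eq: "integral {x..x + h} f = integral {x..x + h} f'"
      by (rule integral_spike[of "{x}"]) (auto simp: f'_def)
    have bounds: "l \<le> f' z \<and> f' z \<le> l + e / 2" if "z \<in> {x..x + h}" for z
    proof (cases "z = x")
      case True
      then show ?thesis using \<open>e > 0\<close> by (simp add: f'_def)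
    next
      case False
      have "z \<in> {x..y}" using that sub' by blast
      then have z: "z \<in> I" "x < z" "z \<le> y" using sub that False by auto
      then have "f z \<le> f y" using mono_onD[OF mono z(1) y(1)] by simp
      then show ?thesis using lower[of z] y(3) z False by (auto simp: f'_def)
    qed
    have "integral {x..x + h} (\<lambda>_. l) \<le> integral {x..x + h} f'"
      by (rule integral_le) (use int bounds in auto)
    moreover have "integral {x..x + h} f' \<le> integral {x..x + h} (\<lambda>_. l + e / 2)"
      by (rule integral_le) (use int bounds in auto)
    ultimately have "h * l \<le> integral {x..x + h} f" "integral {x..x + h} f \<le> h * (l + e / 2)"
      unfolding eq using elim by simp_all
    then have "l \<le> integral {x..x + h} f / h" "integral {x..x + h} f / h \<le> l + e / 2"
      using elim by (simp_all add: field_simps)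
    then show ?case using \<open>e > 0\<close> by (simp add: dist_real_def abs_le_iff)
  qed
qed

text \<open>The stencil of the integral is the integral over \<open>s\<close> in \<open>[0, h]\<close> of the stencil of \<open>f\<close> at the base
  point \<open>x + s\<close>.\<close>

lemma steklov_mean_stencil:
  assumes K: "finite K" and h: "0 < h"
    and mono: "mono_on {u..v} f" and st: "stencil_nonneg_on K c p {u..v} f"
  shows "stencil_nonneg_on K c p {u<..<v - h} (\<lambda>x. integral {x..x + h} f)"
  unfolding stencil_nonneg_on_def
proof (intro allI impI, elim conjE)
  fix x e :: real assume e: "0 < e" and I: "\<forall>i\<in>K. x + e * p i \<in> {u<..<v - h}"
  have int: "(f \<circ> (+) (x + e * p i)) integrable_on {0..h}" if "i \<in> K" for i
  proof (rule integrable_on_mono_on, rule mono_onI)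
    fix r s :: real assume "r \<in> {0..h}" "s \<in> {0..h}" "r \<le> s"
    then show "(f \<circ> (+) (x + e * p i)) r \<le> (f \<circ> (+) (x + e * p i)) s"
      using bspec[OF I that] by (auto intro!: mono_onD[OF mono])
  qed
  have "(\<Sum>i\<in>K. c i * integral {x + e * p i..x + e * p i + h} f)
      = (\<Sum>i\<in>K. integral {0..h} (\<lambda>s. c i * (f \<circ> (+) (x + e * p i)) s))"
  proof (rule sum.cong[OF refl])
    fix i assume "i \<in> K"
    have "integral {x + e * p i..x + e * p i + h} f = integral {0..h} (f \<circ> (+) (x + e * p i))"
      by (simp add: integral_shift_Icc_real add.commute)
    then show "c i * integral {x + e * p i..x + e * p i + h} f
        = integral {0..h} (\<lambda>s. c i * (f \<circ> (+) (x + e * p i)) s)"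
      by (simp only: integral_mult_right)
  qed
  also have "\<dots> = integral {0..h} (\<lambda>s. \<Sum>i\<in>K. c i * (f \<circ> (+) (x + e * p i)) s)"
    using int by (intro integral_sum[symmetric] K integrable_on_mult_right)
  also have "\<dots> \<ge> 0"
  proof (rule integral_nonneg)
    show "(\<lambda>s. \<Sum>i\<in>K. c i * (f \<circ> (+) (x + e * p i)) s) integrable_on {0..h}"
      using int by (intro integrable_sum K integrable_on_mult_right)
    fix s assume s: "s \<in> {0..h}"
    have "\<forall>i\<in>K. (x + s) + e * p i \<in> {u..v}"
    proof
      fix i assume "i \<in> K"
      from bspec[OF I this] s show "(x + s) + e * p i \<in> {u..v}" by auto
    qed
    then have "0 \<le> (\<Sum>i\<in>K. c i * f ((x + s) + e * p i))"
      using st e unfolding stencil_nonneg_on_def by blast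
    then show "0 \<le> (\<Sum>i\<in>K. c i * (f \<circ> (+) (x + e * p i)) s)"
      by (simp add: add_ac)
  qed
  finally show "0 \<le> (\<Sum>i\<in>K. c i * integral {x + e * p i..x + e * p i + h} f)" .
qed

lemma stencil_nonneg_on_subset:
  "stencil_nonneg_on K c p I f \<Longrightarrow> J \<subseteq> I \<Longrightarrow> stencil_nonneg_on K c p J f"
  unfolding stencil_nonneg_on_def by blast

lemma steklov_mean_continuous:
  fixes f :: "real \<Rightarrow> real"
  assumes h: "0 < h" and mono: "mono_on {u..v} f"
  shows "continuous_on {u<..<v - h} (\<lambda>x. integral {x..x + h} f)"
proof -
  define F where "F x = integral {u..x} f" for x
  have int: "f integrable_on {u..v}" by (rule integrable_on_mono_on[OF mono])
  have F: "continuous_on {u..v} F"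
    unfolding F_def by (rule indefinite_integral_continuous_1[OF int])
  have "integral {x..x + h} f = F (x + h) - F x" if "x \<in> {u<..<v - h}" for x
  proof -
    have "f integrable_on {u..x + h}"
      by (rule integrable_subinterval_real[OF int]) (use that h in auto)
    then have "integral {u..x} f + integral {x..x + h} f = integral {u..x + h} f"
      using that h by (intro Henstock_Kurzweil_Integration.integral_combine) auto
    then show ?thesis by (simp add: F_def)
  qed
  moreover have "continuous_on {u<..<v - h} (\<lambda>x. F (x + h) - F x)"
    using h by (intro continuous_intros continuous_on_compose2[OF F]) auto
  ultimately show ?thesis
    by (subst continuous_on_cong[OF refl, where g = "\<lambda>x. F (x + h) - F x"])
qed

text \<open>A monotone function need not be continuous, but its means \<open>x \<mapsto> (\<integral>\<^sub>x\<^bsup>x+h\<^esup> f) / h\<close> are, and they inherit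
  the nonnegative stencil. They are thus \<open>k\<close>-tone, and so is their limit for \<open>h\<close> to 0, the right limit
  \<open>g\<close> of \<open>f\<close>. Since \<open>k \<ge> 2\<close>, \<open>g\<close> is continuous, and a monotone function whose right limits vary
  continuously equals them.\<close>

lemma mono_stencil_imp_k_tone:
  fixes c p :: "'i \<Rightarrow> real"
  assumes K: "finite K" and k: "2 \<le> k"
    and zero: "\<And>m. m < k \<Longrightarrow> (\<Sum>i\<in>K. c i * p i ^ m) = 0"
    and pos: "0 < (\<Sum>i\<in>K. c i * p i ^ k)"
    and I: "open I" "is_interval I" and mono: "mono_on I f"
    and st: "stencil_nonneg_on K c p I f"
  shows "k_tone_on k I f"
proof -
  define g where "g x = Inf (f ` (I \<inter> {x<..}))" for x
  note g = mono_right_limit[OF I mono, folded g_def]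
  have tone: "k_tone_on k I g"
    unfolding k_tone_on_iff_divdiff
  proof (intro allI impI, elim conjE)
    fix S assume S: "finite S" "card S = Suc k" "S \<subseteq> I"
    have Sne: "S \<noteq> {}" using S by auto
    have mm: "Min S \<in> I" "Max S \<in> I" using S Sne by (meson Min_in Max_in subsetD)+
    have "{Min S..Max S} \<subseteq> I"
      using I(2) mm by (meson atLeastAtMost_iff mem_is_interval_1_I subsetI)
    moreover have "Min S \<le> Max S" using S(1) Sne by simp
    ultimately obtain u v where uv: "u < Min S" "Max S < v" "{u..v} \<subseteq> I"
      using open_interval_enlarge[OF I, of "Min S" "Max S"] by blast
    have mono': "mono_on {u..v} f" by (rule mono_on_subset[OF mono uv(3)])
    have "eventually (\<lambda>h. 0 < h \<and> h < v - Max S) (at_right 0)"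
      using uv by (intro eventually_at_rightI[of 0 "v - Max S"]) auto
    then have ev: "eventually (\<lambda>h. 0 \<le> divdiff (\<lambda>x. integral {x..x + h} f / h) S) (at_right 0)"
    proof eventually_elim
      case (elim h)
      have SJ: "S \<subseteq> {u<..<v - h}"
      proof
        fix x assume "x \<in> S"
        then have "Min S \<le> x" "x \<le> Max S" using S(1) by auto
        then show "x \<in> {u<..<v - h}" using uv elim by auto
      qed
      then have "u < v - h" using Sne by fastforce
      then have "k_tone_on k (einterval u (v - h)) (\<lambda>x. integral {x..x + h} f)"
        using k steklov_mean_continuous[OF _ mono', of h] elim
          steklov_mean_stencil[OF K _ mono' stencil_nonneg_on_subset[OF st uv(3)], of h]
        by (intro stencil_imp_k_tone[OF K _ zero pos]) auto
      then have "0 \<le> divdiff (\<lambda>x. integral {x..x + h} f) S"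
        by (rule k_tone_onD) (use S SJ in auto)
      then show ?case
        using divdiff_cmult[of "1 / h" "\<lambda>x. integral {x..x + h} f" S] elim by simp
    qed
    have "((\<lambda>h. divdiff (\<lambda>x. integral {x..x + h} f / h) S) \<longlongrightarrow> divdiff g S) (at_right 0)"
      unfolding divdiff_def
    proof (intro tendsto_sum tendsto_divide tendsto_const)
      fix x assume "x \<in> S"
      then have x: "x \<in> I" using S by blast
      show "((\<lambda>h. integral {x..x + h} f / h) \<longlongrightarrow> g x) (at_right 0)"
        by (rule steklov_mean_tendsto[OF I(2) mono x g(2)[OF x] g(3)[OF x]])
      show "(\<Prod>y\<in>S - {x}. x - y) \<noteq> 0" using S by auto
    qed
    then show "0 \<le> divdiff g S" using ev by (intro tendsto_lowerbound) auto
  qed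
  have "f x = g x" if x: "x \<in> I" for x
  proof (rule antisym)
    show "f x \<le> g x" by (rule g(1)[OF x])
    have "continuous_on I g" using k by (intro k_tone_continuous[OF I tone]) auto
    then have "(g \<longlongrightarrow> g x) (at x)"
      using I x by (simp add: continuous_on_eq_continuous_at isCont_def)
    then have "(g \<longlongrightarrow> g x) (at_left x)"
      by (rule tendsto_mono[rotated]) (simp add: at_le)
    moreover have "eventually (\<lambda>y. g y \<le> f x) (at_left x)"
    proof -
      obtain a b where ab: "a < x" "x < b" "{a..b} \<subseteq> I" using nbhd_Icc[OF I x] .
      show ?thesis
      proof (rule eventually_at_leftI[OF _ ab(1)])
        fix y assume "y \<in> {a<..<x}"
        then have "y \<in> {a..b}" "y < x" using ab by auto
        then show "g y \<le> f x" using g(2)[OF _ x] ab(3) by blast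
      qed
    qed
    ultimately show "g x \<le> f x" by (intro tendsto_upperbound) auto
  qed
  then show ?thesis
    using tone unfolding k_tone_on_iff_divdiff by (metis divdiff_cong subsetD)
qed

section \<open>Functional calculus in coordinates\<close>

lemma mat_adjoint_index:
  assumes "A \<in> carrier_mat n m" "i < m" "j < n"
  shows "mat_adjoint A $$ (i, j) = cnj (A $$ (j, i))"
  using assms by (simp add: mat_adjoint_def mat_of_rows_index)

lemma unitary_conj_carrier:
  "U \<in> carrier_mat n n \<Longrightarrow> unitary_conj n U d \<in> carrier_mat n n"
  by (auto simp: unitary_conj_def mat_adjoint_carrier intro!: mult_carrier_mat[of _ n n])

text \<open>With \<open>f \<circ> d\<close> in place of \<open>d\<close> this shows that a diagonal entry of \<open>f(A)\<close> is a combination of the values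
  of \<open>f\<close> at the eigenvalues of \<open>A\<close>, which is how point values of \<open>f\<close> enter the proof.\<close>

lemma unitary_conj_index:
  assumes U: "U \<in> carrier_mat n n" and ij: "i < n" "j < n"
  shows "unitary_conj n U d $$ (i, j)
    = (\<Sum>l<n. U $$ (i, l) * complex_of_real (d l) * cnj (U $$ (j, l)))"
proof -
  have *: "U * mat_diag n (\<lambda>i. complex_of_real (d i))
      = Matrix.mat n n (\<lambda>(i, j). U $$ (i, j) * complex_of_real (d j))"
    using U by (simp add: mat_diag_mult_right)
  show ?thesis
    unfolding unitary_conj_def * using U ij mat_adjoint_carrier[OF U]
    by (simp add: scalar_prod_def atLeast0LessThan mat_adjoint_index[OF U])
qed

lemma unitary_conj_hermitian:
  assumes U: "U \<in> carrier_mat n n"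
  shows "unitary_conj n U d \<in> hermitian_mats n"
  unfolding hermitian_mats_def
proof (intro CollectI conjI)
  note C = unitary_conj_carrier[OF U, of d]
  show "unitary_conj n U d \<in> carrier_mat n n" by (rule C)
  show "mat_adjoint (unitary_conj n U d) = unitary_conj n U d"
  proof (rule eq_matI)
    fix i j assume "i < dim_row (unitary_conj n U d)" "j < dim_col (unitary_conj n U d)"
    then have ij: "i < n" "j < n" using C by auto
    then show "mat_adjoint (unitary_conj n U d) $$ (i, j) = unitary_conj n U d $$ (i, j)"
      by (simp add: mat_adjoint_index[OF C] unitary_conj_index[OF U] mult_ac)
  qed (use C mat_adjoint_carrier[OF C] in auto)
qed

lemma spectrum_unitary_conj:
  assumes U: "U \<in> unitary_mats n"
  shows "spectrum (unitary_conj n U d) \<subseteq> complex_of_real ` d ` {..<n}"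
proof
  fix \<mu> assume "\<mu> \<in> spectrum (unitary_conj n U d)"
  have Uc: "U \<in> carrier_mat n n" "mat_adjoint U \<in> carrier_mat n n"
    and UU: "U * mat_adjoint U = 1\<^sub>m n" "mat_adjoint U * U = 1\<^sub>m n"
    using U by (auto simp: unitary_mats_def mat_adjoint_carrier)
  let ?D = "mat_diag n (\<lambda>i. complex_of_real (d i))"
  have Dc: "?D \<in> carrier_mat n n" by simp
  note C = unitary_conj_carrier[OF Uc(1), of d]
  have "similar_mat (unitary_conj n U d) ?D"
    by (rule similar_matI[of _ _ U "mat_adjoint U" n]) (use Uc UU C in \<open>auto simp: unitary_conj_def\<close>)
  then have "char_poly (unitary_conj n U d) = char_poly ?D" by (rule char_poly_similar)
  also have "\<dots> = (\<Prod>a\<leftarrow>diag_mat ?D. [:- a, 1:])"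
    by (rule char_poly_upper_triangular[OF Dc]) (simp add: mat_diag_def upper_triangular_def)
  finally have "poly (\<Prod>a\<leftarrow>diag_mat ?D. [:- a, 1:]) \<mu> = 0"
    using \<open>\<mu> \<in> spectrum _\<close> eigenvalue_root_char_poly[OF C] by (simp add: spectrum_def)
  then have "\<mu> \<in> set (diag_mat ?D)"
    by (auto simp: poly_prod_list prod_list_zero_iff)
  then show "\<mu> \<in> complex_of_real ` d ` {..<n}"
    by (auto simp: diag_mat_def mat_diag_def)
qed

lemma unitary_conj_hermitian_on:
  assumes "U \<in> unitary_mats n" "\<And>j. j < n \<Longrightarrow> d j \<in> I"
  shows "unitary_conj n U d \<in> hermitian_mats_on n I"
proof -
  have "d ` {..<n} \<subseteq> I" using assms(2) by auto
  then have "spectrum (unitary_conj n U d) \<subseteq> complex_of_real ` I"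
    using spectrum_unitary_conj[OF assms(1), of d] by (meson image_mono order_trans)
  moreover have "U \<in> carrier_mat n n" using assms(1) by (simp add: unitary_mats_def)
  ultimately show ?thesis by (simp add: hermitian_mats_on_def unitary_conj_hermitian)
qed

lemma pos_semidef_diag_entry:
  assumes "pos_semidef n A" "r < n"
  shows "0 \<le> Re (A $$ (r, r))"
proof -
  have A: "A \<in> carrier_mat n n" using assms by (simp add: pos_semidef_def hermitian_mats_def)
  have "0 \<le> (A *\<^sub>v unit_vec n r) \<bullet>c unit_vec n r"
    using assms by (simp add: pos_semidef_def)
  also have "(A *\<^sub>v unit_vec n r) \<bullet>c unit_vec n r = A $$ (r, r)"
  proof -
    have "conjugate (unit_vec n r :: complex Matrix.vec) = unit_vec n r"
      by (intro eq_vecI) (auto simp: unit_vec_def)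
    then show ?thesis using A assms(2) by simp
  qed
  finally show ?thesis by (simp add: less_eq_complex_def)
qed

lemma loewner_le_diag_entry:
  assumes "loewner_le n A B" "r < n"
  shows "Re (A $$ (r, r)) \<le> Re (B $$ (r, r))"
proof -
  have "A \<in> carrier_mat n n" "B \<in> carrier_mat n n" "pos_semidef n (B - A)"
    using assms(1) by (auto simp: loewner_le_def hermitian_mats_def)
  with pos_semidef_diag_entry[of n "B - A" r] assms(2) show ?thesis by simp
qed

lemma pos_semidef_mat_diag:
  assumes g: "\<And>i. i < n \<Longrightarrow> 0 \<le> g i"
  shows "pos_semidef n (mat_diag n (\<lambda>i. complex_of_real (g i)))" (is "pos_semidef n ?D")
  unfolding pos_semidef_def
proof (intro conjI ballI)
  have D: "?D \<in> carrier_mat n n" by simp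
  show "?D \<in> hermitian_mats n"
    unfolding hermitian_mats_def
  proof (intro CollectI conjI D eq_matI)
    fix i j assume "i < dim_row ?D" "j < dim_col ?D"
    then have ij: "i < n" "j < n" by (auto simp: mat_diag_def)
    then show "mat_adjoint ?D $$ (i, j) = ?D $$ (i, j)"
      unfolding mat_adjoint_index[OF D ij] by (simp add: mat_diag_def)
  qed (use carrier_matD[OF D] carrier_matD[OF mat_adjoint_carrier[OF D]] in simp_all)
  fix v :: "complex Matrix.vec" assume v: "v \<in> carrier_vec n"
  have "(?D *\<^sub>v v) $ i = g i * v $ i" if "i < n" for i
  proof -
    have "(?D *\<^sub>v v) $ i = (\<Sum>j<n. (if i = j then complex_of_real (g j) else 0) * v $ j)"
      using that v by (simp add: mat_diag_def scalar_prod_def atLeast0LessThan)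
    also have "\<dots> = (\<Sum>j<n. if i = j then g j * v $ j else 0)" by (intro sum.cong) auto
    finally show ?thesis using that by simp
  qed
  then have "(?D *\<^sub>v v) \<bullet>c v = (\<Sum>i<n. g i * v $ i * cnj (v $ i))"
    using v by (simp add: scalar_prod_def atLeast0LessThan)
  also have "\<dots> = complex_of_real (\<Sum>i<n. g i * (cmod (v $ i))\<^sup>2)"
    by (simp add: mult.assoc complex_norm_square[symmetric] flip: of_real_power)
  also have "0 \<le> \<dots>"
    using g by (auto simp: less_eq_complex_def intro!: sum_nonneg)
  finally show "0 \<le> (?D *\<^sub>v v) \<bullet>c v" .
qed

section \<open>Orthonormal eigenbases\<close>

definition orthonormal_family :: "nat \<Rightarrow> (nat \<Rightarrow> nat \<Rightarrow> real) \<Rightarrow> bool" where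
  "orthonormal_family n u \<longleftrightarrow>
     (\<forall>j<n. \<forall>k<n. (\<Sum>i<n. u j i * u k i) = (if j = k then 1 else 0))"

definition column_mat :: "nat \<Rightarrow> (nat \<Rightarrow> nat \<Rightarrow> real) \<Rightarrow> complex mat" where
  "column_mat n u = Matrix.mat n n (\<lambda>(i, j). complex_of_real (u j i))"

lemma column_mat_carrier [simp]: "column_mat n u \<in> carrier_mat n n"
  by (simp add: column_mat_def)

lemma column_mat_index:
  "i < n \<Longrightarrow> j < n \<Longrightarrow> column_mat n u $$ (i, j) = complex_of_real (u j i)"
  by (simp add: column_mat_def)

lemma column_mat_unitary:
  assumes "orthonormal_family n u"
  shows "column_mat n u \<in> unitary_mats n"
proof -
  let ?U = "column_mat n u"
  have Uc: "?U \<in> carrier_mat n n" "mat_adjoint ?U \<in> carrier_mat n n"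
    by (auto intro: mat_adjoint_carrier)
  have "mat_adjoint ?U * ?U = 1\<^sub>m n"
  proof (rule eq_matI)
    fix j k assume "j < dim_row (1\<^sub>m n)" "k < dim_col (1\<^sub>m n)"
    then have jk: "j < n" "k < n" by auto
    have "(mat_adjoint ?U * ?U) $$ (j, k) = (\<Sum>i<n. mat_adjoint ?U $$ (j, i) * ?U $$ (i, k))"
      using jk carrier_matD[OF Uc(1)] carrier_matD[OF Uc(2)]
      by (simp add: scalar_prod_def atLeast0LessThan)
    also have "\<dots> = complex_of_real (\<Sum>i<n. u j i * u k i)"
      using jk by (simp add: mat_adjoint_index[OF Uc(1)] column_mat_index)
    also have "\<dots> = 1\<^sub>m n $$ (j, k)"
      using assms jk by (simp add: orthonormal_family_def)
    finally show "(mat_adjoint ?U * ?U) $$ (j, k) = 1\<^sub>m n $$ (j, k)" .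
  qed (use carrier_matD[OF Uc(1)] carrier_matD[OF Uc(2)] in simp_all)
  moreover from this have "?U * mat_adjoint ?U = 1\<^sub>m n"
    by (rule mat_mult_left_right_inverse[OF Uc(2,1)])
  ultimately show ?thesis using Uc by (simp add: unitary_mats_def)
qed

lemma column_mat_conj_index:
  assumes "i < n" "j < n"
  shows "unitary_conj n (column_mat n u) d $$ (i, j) = complex_of_real (\<Sum>l<n. d l * u l i * u l j)"
  using assms by (simp add: unitary_conj_index column_mat_index mult_ac)

text \<open>A left inverse of a square matrix is a right inverse, so orthonormal columns give orthonormal rows.\<close>

lemma orthonormal_family_complete:
  assumes "orthonormal_family n u" "i < n" "j < n"
  shows "(\<Sum>l<n. u l i * u l j) = (if i = j then 1 else 0)"
proof -
  have U: "column_mat n u \<in> unitary_mats n" by (rule column_mat_unitary[OF assms(1)])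
  have "mat_diag n (\<lambda>i. complex_of_real 1) = 1\<^sub>m n"
    by (intro eq_matI) (auto simp: mat_diag_def)
  then have "unitary_conj n (column_mat n u) (\<lambda>_. 1) = 1\<^sub>m n"
    using U by (simp add: unitary_conj_def unitary_mats_def right_mult_one_mat[OF column_mat_carrier])
  then have "complex_of_real (\<Sum>l<n. u l i * u l j) = 1\<^sub>m n $$ (i, j)"
    using column_mat_conj_index[OF assms(2,3), of u "\<lambda>_. 1"] by simp
  also have "\<dots> = complex_of_real (if i = j then 1 else 0)" using assms by simp
  finally show ?thesis by (simp only: of_real_eq_iff)
qed

definition eigenbasis :: "nat \<Rightarrow> (nat \<Rightarrow> nat \<Rightarrow> real) \<Rightarrow> (nat \<Rightarrow> nat \<Rightarrow> real) \<Rightarrow> (nat \<Rightarrow> real) \<Rightarrow> bool" where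
  "eigenbasis n S u d \<longleftrightarrow> orthonormal_family n u \<and>
     (\<forall>j<n. \<forall>i<n. (\<Sum>l<n. S i l * u j l) = d j * u j i)"

lemma eigenbasis_unitary_conj:
  assumes "eigenbasis n S u d" "i < n" "j < n"
  shows "unitary_conj n (column_mat n u) (\<lambda>l. x + e * d l) $$ (i, j)
     = complex_of_real ((if i = j then x else 0) + e * S i j)"
proof -
  have on: "orthonormal_family n u" and ev: "\<And>j i. j < n \<Longrightarrow> i < n \<Longrightarrow> (\<Sum>l<n. S i l * u j l) = d j * u j i"
    using assms(1) by (auto simp: eigenbasis_def)
  have "(\<Sum>l<n. (x + e * d l) * u l i * u l j)
      = x * (\<Sum>l<n. u l i * u l j) + e * (\<Sum>l<n. d l * u l i * u l j)"
    by (simp add: sum.distrib sum_distrib_left algebra_simps)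
  also have "(\<Sum>l<n. d l * u l i * u l j) = (\<Sum>l<n. (\<Sum>m<n. S i m * u l m) * u l j)"
    using assms by (intro sum.cong) (simp_all add: ev)
  also have "\<dots> = (\<Sum>m<n. S i m * (\<Sum>l<n. u l m * u l j))"
    by (simp add: sum_distrib_left sum_distrib_right mult.assoc) (rule sum.swap)
  also have "\<dots> = (\<Sum>m<n. if m = j then S i m else 0)"
    using assms on by (intro sum.cong) (simp_all add: orthonormal_family_complete)
  also have "\<dots> = S i j" using assms by simp
  finally show ?thesis
    unfolding column_mat_conj_index[OF assms(2,3)]
    using assms on by (simp add: orthonormal_family_complete)
qed

text \<open>Eigenvectors of a symmetric matrix for distinct eigenvalues are orthogonal, so only their lengths
  have to be adjusted.\<close>

lemma normalized_eigenbasis: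
  fixes v :: "nat \<Rightarrow> nat \<Rightarrow> real"
  assumes sym: "\<And>i j. S i j = S j i"
    and ev: "\<And>j i. j < n \<Longrightarrow> i < n \<Longrightarrow> (\<Sum>l<n. S i l * v j l) = d j * v j i"
    and dist: "inj_on d {..<n}"
    and nz: "\<And>j. j < n \<Longrightarrow> \<exists>i<n. v j i \<noteq> 0"
  shows "\<exists>u. eigenbasis n S u d"
proof -
  define N where "N j = (\<Sum>i<n. v j i * v j i)" for j
  have N: "N j > 0" if j: "j < n" for j
  proof -
    obtain i where "i < n" "v j i \<noteq> 0" using nz[OF j] by blast
    then show ?thesis unfolding N_def by (intro sum_pos2[of _ i]) (auto simp: zero_less_mult_iff linorder_neq_iff)
  qed
  have orth: "(\<Sum>i<n. v j i * v k i) = 0" if "j < n" "k < n" "j \<noteq> k" for j k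
  proof -
    have "d j * (\<Sum>i<n. v j i * v k i) = (\<Sum>i<n. (\<Sum>l<n. S i l * v j l) * v k i)"
      using that by (simp add: ev sum_distrib_left mult.assoc)
    also have "\<dots> = (\<Sum>l<n. v j l * (\<Sum>i<n. S l i * v k i))"
      unfolding sum_distrib_left sum_distrib_right
      by (subst sum.swap, intro sum.cong refl) (simp add: sym mult_ac)
    also have "\<dots> = d k * (\<Sum>i<n. v j i * v k i)"
      using that by (simp add: ev sum_distrib_left mult_ac)
    finally show ?thesis using dist that by (auto simp: inj_on_def)
  qed
  define u where "u j i = v j i / sqrt (N j)" for j i
  have "orthonormal_family n u"
    unfolding orthonormal_family_def
  proof (intro allI impI)
    fix j k assume jk: "j < n" "k < n"
    have "(\<Sum>i<n. u j i * u k i) = (\<Sum>i<n. v j i * v k i) / (sqrt (N j) * sqrt (N k))"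
      by (simp add: u_def sum_divide_distrib)
    then show "(\<Sum>i<n. u j i * u k i) = (if j = k then 1 else 0)"
      using orth[OF jk] N[OF jk(1)] by (auto simp: N_def[symmetric])
  qed
  moreover have "(\<Sum>l<n. S i l * u j l) = d j * u j i" if "j < n" "i < n" for i j
    using ev[OF that] by (simp add: u_def flip: sum_divide_distrib)
  ultimately show ?thesis by (auto simp: eigenbasis_def)
qed

section \<open>The path graph with a weighted loop\<close>

text \<open>The adjacency matrix of the path graph on the vertices \<open>0, 1, 2, \<dots>\<close>, with a loop of weight \<open>\<sigma>\<close> at the
  vertex 0. Only its leading \<open>n \<times> n\<close> block is used, with \<open>\<sigma>\<close> equal to 0, 1 or \<open>-1\<close>.\<close>

definition path_mat :: "real \<Rightarrow> nat \<Rightarrow> nat \<Rightarrow> real" where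
  "path_mat \<sigma> i j = (if i = 0 \<and> j = 0 then \<sigma> else if i = Suc j \<or> j = Suc i then 1 else 0)"

lemma path_mat_sym: "path_mat \<sigma> i j = path_mat \<sigma> j i"
  by (auto simp: path_mat_def)

lemma path_mat_row_sum:
  assumes "i < n"
  shows "(\<Sum>l<n. path_mat \<sigma> i l * v l)
    = (if i = 0 then \<sigma> * v 0 else v (i - 1)) + (if Suc i < n then v (Suc i) else 0)"
proof -
  have "(\<Sum>l<n. path_mat \<sigma> i l * v l)
     = (\<Sum>l<n. (if l = i - 1 then (if i = 0 then \<sigma> * v 0 else v (i - 1)) else 0)
         + (if l = Suc i then v (Suc i) else 0))"
    by (intro sum.cong) (auto simp: path_mat_def)
  also have "\<dots> = (if i = 0 then \<sigma> * v 0 else v (i - 1)) + (if Suc i < n then v (Suc i) else 0)"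
    using assms by (simp add: sum.distrib)
  finally show ?thesis .
qed

text \<open>The vector \<open>l \<mapsto> sin ((n - l) \<theta>)\<close> satisfies the three-term recurrence in the interior and vanishes at the
  absent vertex \<open>n\<close>. The condition on \<open>\<theta>\<close> is the boundary condition at the loop: the value
  \<open>sin ((n + 1) \<theta>)\<close> at the absent vertex \<open>-1\<close> is \<open>\<sigma>\<close> times the value at 0.\<close>

lemma path_mat_eigenvector:
  fixes \<theta> \<sigma> :: real
  assumes "sin (real (n + 1) * \<theta>) = \<sigma> * sin (real n * \<theta>)" "i < n"
  shows "(\<Sum>l<n. path_mat \<sigma> i l * sin (real (n - l) * \<theta>))
     = 2 * cos \<theta> * sin (real (n - i) * \<theta>)"
proof -
  have three: "sin (real (Suc m + 1) * \<theta>) + sin (real m * \<theta>) = 2 * cos \<theta> * sin (real (Suc m) * \<theta>)" for m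
  proof -
    have "real (Suc m + 1) * \<theta> = real (Suc m) * \<theta> + \<theta>" "real m * \<theta> = real (Suc m) * \<theta> - \<theta>"
      by (simp_all add: algebra_simps)
    then show ?thesis by (simp only: sin_add sin_diff) simp
  qed
  obtain m where m: "n - i = Suc m" using assms(2) by (metis Suc_diff_Suc)
  have "(if Suc i < n then sin (real (n - Suc i) * \<theta>) else 0) = sin (real m * \<theta>)"
  proof (cases "Suc i < n")
    case True
    have "n - Suc i = m" using m by simp
    then show ?thesis using True by (simp only: if_True)
  next
    case False
    then have "m = 0" using m by simp
    then show ?thesis using False by simp
  qed
  moreover have "(if i = 0 then \<sigma> * sin (real (n - 0) * \<theta>) else sin (real (n - (i - 1)) * \<theta>))
      = sin (real (Suc m + 1) * \<theta>)"
  proof (cases "i = 0")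
    case True
    then show ?thesis using assms(1) m by simp
  next
    case False
    then have "n - (i - 1) = Suc m + 1" using m by simp
    then show ?thesis using False by simp
  qed
  ultimately show ?thesis
    unfolding path_mat_row_sum[OF assms(2)] using three[of m] m by simp
qed

lemma sin_add_2npi: "sin (x + real m * (2 * pi)) = sin x"
  using sin_2npi[of m] cos_2npi[of m] by (simp add: sin_add mult_ac)

text \<open>For the three loop weights the boundary condition is solved explicitly, by
  \<open>\<theta> = (j + 1) \<pi> / (n + 1)\<close> for \<open>\<sigma> = 0\<close>, \<open>\<theta> = (2 j + 1) \<pi> / (2 n + 1)\<close> for \<open>\<sigma> = 1\<close> and
  \<open>\<theta> = (2 j + 2) \<pi> / (2 n + 1)\<close> for \<open>\<sigma> = -1\<close>. These angles lie in \<open>(0, \<pi>)\<close>, where the cosine is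
  injective, so there are \<open>n\<close> distinct eigenvalues and the general spectral theorem is avoided.\<close>

lemma path_mat_eigenbasis:
  assumes "\<sigma> \<in> {-1, 0, 1}"
  shows "\<exists>u d. eigenbasis n (path_mat \<sigma>) u d"
proof -
  have "\<exists>D (q :: nat \<Rightarrow> nat). inj_on q {..<n} \<and> (\<forall>j<n. 0 < q j \<and> q j < D \<and>
      sin (real (n + 1) * (real (q j) * pi / real D)) = \<sigma> * sin (real n * (real (q j) * pi / real D)))"
  proof -
    consider "\<sigma> = 0" | "\<sigma> = 1" | "\<sigma> = -1" using assms by auto
    then show ?thesis
    proof cases
      case 1
      have "sin (real (n + 1) * (real (j + 1) * pi / real (n + 1)))
          = \<sigma> * sin (real n * (real (j + 1) * pi / real (n + 1)))" for j
      proof -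
        have "real (n + 1) * (real (j + 1) * pi / real (n + 1)) = real (j + 1) * pi" by simp
        then show ?thesis unfolding 1 by (simp only: sin_npi)
      qed
      then show ?thesis
        by (intro exI[of _ "n + 1"] exI[of _ "\<lambda>j. j + 1"]) (simp add: inj_on_def)
    next
      case 2
      have "sin (real (n + 1) * (real (2 * j + 1) * pi / real (2 * n + 1)))
          = \<sigma> * sin (real n * (real (2 * j + 1) * pi / real (2 * n + 1)))" for j
      proof -
        let ?t = "real (2 * j + 1) * pi / real (2 * n + 1)"
        have "real (2 * n + 1) * ?t = real (2 * j + 1) * pi" by simp
        moreover have "real (n + 1) * ?t = real (2 * n + 1) * ?t - real n * ?t"
          by (simp only: left_diff_distrib[symmetric]) simp
        ultimately have "real (n + 1) * ?t = (pi - real n * ?t) + real j * (2 * pi)"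
          by (simp only:) (simp add: algebra_simps)
        then show ?thesis unfolding 2 by (simp only: sin_add_2npi sin_pi_minus)
      qed
      then show ?thesis
        by (intro exI[of _ "2 * n + 1"] exI[of _ "\<lambda>j. 2 * j + 1"]) (simp add: inj_on_def)
    next
      case 3
      have "sin (real (n + 1) * (real (2 * j + 2) * pi / real (2 * n + 1)))
          = \<sigma> * sin (real n * (real (2 * j + 2) * pi / real (2 * n + 1)))" for j
      proof -
        let ?t = "real (2 * j + 2) * pi / real (2 * n + 1)"
        have "real (2 * n + 1) * ?t = real (2 * j + 2) * pi" by simp
        moreover have "real (n + 1) * ?t = real (2 * n + 1) * ?t - real n * ?t"
          by (simp only: left_diff_distrib[symmetric]) simp
        ultimately have "real (n + 1) * ?t = (- (real n * ?t)) + real (j + 1) * (2 * pi)"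
          by (simp only:) (simp add: algebra_simps)
        then show ?thesis unfolding 3 by (simp only: sin_add_2npi sin_minus)
      qed
      then show ?thesis
        by (intro exI[of _ "2 * n + 1"] exI[of _ "\<lambda>j. 2 * j + 2"]) (simp add: inj_on_def)
    qed
  qed
  then obtain D and q :: "nat \<Rightarrow> nat" where q: "inj_on q {..<n}"
      "\<And>j. j < n \<Longrightarrow> 0 < q j" "\<And>j. j < n \<Longrightarrow> q j < D"
      "\<And>j. j < n \<Longrightarrow> sin (real (n + 1) * (real (q j) * pi / real D))
        = \<sigma> * sin (real n * (real (q j) * pi / real D))"
    by blast
  define \<theta> where "\<theta> j = real (q j) * pi / real D" for j
  have \<theta>: "0 < \<theta> j \<and> \<theta> j < pi" if "j < n" for j
    using q(2,3)[OF that] by (simp add: \<theta>_def field_simps)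
  have \<theta>_inj: "j = k" if "j < n" "k < n" "\<theta> j = \<theta> k" for j k
    using that q(1) q(3)[OF that(1)] by (simp add: \<theta>_def inj_on_def)
  have "\<exists>u. eigenbasis n (path_mat \<sigma>) u (\<lambda>j. 2 * cos (\<theta> j))"
  proof (rule normalized_eigenbasis[where v = "\<lambda>j i. sin (real (n - i) * \<theta> j)"])
    show "inj_on (\<lambda>j. 2 * cos (\<theta> j)) {..<n}"
    proof (rule inj_onI)
      fix j k assume jk: "j \<in> {..<n}" "k \<in> {..<n}" "2 * cos (\<theta> j) = 2 * cos (\<theta> k)"
      then have "\<theta> j = \<theta> k" using \<theta>[of j] \<theta>[of k] by (auto intro: cos_inj_pi[of "\<theta> j" "\<theta> k"])
      then show "j = k" using \<theta>_inj jk by auto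
    qed
    show "\<exists>i<n. sin (real (n - i) * \<theta> j) \<noteq> 0" if j: "j < n" for j
    proof (intro exI conjI)
      \<comment> \<open>The last coordinate of the eigenvector is \<open>sin \<theta> > 0\<close>.\<close>
      show "n - 1 < n" using j by simp
      have "n - (n - 1) = 1" using j by simp
      then show "sin (real (n - (n - 1)) * \<theta> j) \<noteq> 0"
        using \<theta>[OF j] sin_gt_zero[of "\<theta> j"] by simp
    qed
    show "(\<Sum>l<n. path_mat \<sigma> i l * sin (real (n - l) * \<theta> j))
        = 2 * cos (\<theta> j) * sin (real (n - i) * \<theta> j)" if "j < n" "i < n" for i j
      by (rule path_mat_eigenvector[OF q(4)[OF that(1), folded \<theta>_def] that(2)])
  qed (rule path_mat_sym)
  then show ?thesis by blast
qed

definition mat_op :: "nat \<Rightarrow> (nat \<Rightarrow> nat \<Rightarrow> real) \<Rightarrow> (nat \<Rightarrow> real) \<Rightarrow> nat \<Rightarrow> real" where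
  "mat_op n S v i = (\<Sum>l<n. S i l * v l)"

definition delta :: "nat \<Rightarrow> nat \<Rightarrow> real" where
  "delta r i = (if i = r then 1 else 0)"

text \<open>Both sides are the \<open>(r, r)\<close> entry of \<open>S ^ (l + m)\<close>: on the left through the eigenbasis, on the right
  as the inner product of \<open>S ^ l e\<^sub>r\<close> and \<open>S ^ m e\<^sub>r\<close>. The exponent is split so that
  the two factors, applied to the path with a loop, each see the loop at most once.\<close>

lemma eigenbasis_moment:
  assumes eb: "eigenbasis n S u d" and sym: "\<And>i j. S i j = S j i" and r: "r < n"
  shows "(\<Sum>j<n. (u j r)\<^sup>2 * d j ^ (l + m))
     = (\<Sum>i<n. (mat_op n S ^^ l) (delta r) i * (mat_op n S ^^ m) (delta r) i)"
proof -
  have on: "orthonormal_family n u" and ev: "\<And>j i. j < n \<Longrightarrow> i < n \<Longrightarrow> (\<Sum>l<n. S i l * u j l) = d j * u j i"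
    using eb by (auto simp: eigenbasis_def)
  have coef: "(\<Sum>i<n. u j i * (mat_op n S ^^ l) (delta r) i) = d j ^ l * u j r" if j: "j < n" for j l
  proof (induction l)
    case 0
    have "(\<Sum>i<n. u j i * delta r i) = (\<Sum>i<n. if i = r then u j i else 0)"
      by (intro sum.cong) (auto simp: delta_def)
    then show ?case using r by simp
  next
    case (Suc l)
    let ?v = "(mat_op n S ^^ l) (delta r)"
    have "(\<Sum>i<n. u j i * mat_op n S ?v i) = (\<Sum>k<n. (\<Sum>i<n. S k i * u j i) * ?v k)"
      unfolding mat_op_def sum_distrib_left sum_distrib_right
      by (subst sum.swap, intro sum.cong refl) (simp add: sym mult_ac)
    also have "\<dots> = d j * (\<Sum>k<n. u j k * ?v k)"
      using j by (simp add: ev sum_distrib_left mult.assoc)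
    finally show ?case using Suc.IH by simp
  qed
  let ?a = "(mat_op n S ^^ l) (delta r)" and ?b = "(mat_op n S ^^ m) (delta r)"
  have "(\<Sum>j<n. (u j r)\<^sup>2 * d j ^ (l + m)) = (\<Sum>j<n. (\<Sum>i<n. u j i * ?a i) * (\<Sum>k<n. u j k * ?b k))"
    by (intro sum.cong) (simp_all add: coef power_add power2_eq_square)
  also have "\<dots> = (\<Sum>j<n. \<Sum>i<n. \<Sum>k<n. ?a i * ?b k * (u j i * u j k))"
    by (simp add: sum_product mult_ac)
  also have "\<dots> = (\<Sum>i<n. \<Sum>k<n. \<Sum>j<n. ?a i * ?b k * (u j i * u j k))"
    by (rule trans[OF sum.swap], rule sum.cong[OF refl], rule sum.swap)
  also have "\<dots> = (\<Sum>i<n. \<Sum>k<n. if i = k then ?a i * ?b k else 0)"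
    using on by (intro sum.cong refl) (simp add: orthonormal_family_complete flip: sum_distrib_left)
  also have "\<dots> = (\<Sum>i<n. ?a i * ?b i)" by simp
  finally show ?thesis .
qed

lemma path_mat_loop:
  assumes "0 < n"
  shows "mat_op n (path_mat \<sigma>) v = (\<lambda>i. mat_op n (path_mat 0) v i + (if i = 0 then \<sigma> * v 0 else 0))"
proof
  fix i
  have "mat_op n (path_mat \<sigma>) v i
      = (\<Sum>l<n. path_mat 0 i l * v l + (if l = 0 then if i = 0 then \<sigma> * v 0 else 0 else 0))"
    unfolding mat_op_def by (intro sum.cong) (auto simp: path_mat_def)
  also have "\<dots> = mat_op n (path_mat 0) v i + (if i = 0 then \<sigma> * v 0 else 0)"
    using assms by (simp add: sum.distrib mat_op_def)
  finally show "mat_op n (path_mat \<sigma>) v i = mat_op n (path_mat 0) v i + (if i = 0 then \<sigma> * v 0 else 0)" .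
qed

text \<open>The entry at \<open>i\<close> counts the walks of length \<open>l\<close> from the last vertex \<open>n - 1\<close> to \<open>i\<close> that avoid the
  loop (for \<open>i < n\<close>).\<close>

definition path_walk :: "nat \<Rightarrow> nat \<Rightarrow> nat \<Rightarrow> real" where
  "path_walk n l = (mat_op n (path_mat 0) ^^ l) (delta (n - 1))"

lemma path_walk_front:
  assumes "l < n" "i < n"
  shows "i + l < n - 1 \<Longrightarrow> path_walk n l i = 0" "i + l = n - 1 \<Longrightarrow> path_walk n l i = 1"
  using assms
proof (induction l arbitrary: i)
  case 0
  {
    case 1
    then show ?case by (simp add: path_walk_def delta_def)
  next
    case 2
    then show ?case by (simp add: path_walk_def delta_def)
  }
next
  case (Suc l)
  have step: "path_walk n (Suc l) i
      = (if i = 0 then 0 else path_walk n l (i - 1)) + (if Suc i < n then path_walk n l (Suc i) else 0)"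
    if "i < n" for i
    using path_mat_row_sum[OF that, of 0 "path_walk n l"] by (simp add: path_walk_def mat_op_def)
  {
    case 1
    then have "Suc i < n" by linarith
    then show ?case using 1 Suc.IH(1)[of "i - 1"] Suc.IH(1)[of "Suc i"] by (simp add: step)
  next
    case 2
    then show ?case using Suc.IH(1)[of "i - 1"] Suc.IH(2)[of "Suc i"] by (auto simp: step)
  }
qed

text \<open>A walk of fewer than \<open>n\<close> steps from the vertex \<open>n - 1\<close> cannot have used the loop at the vertex 0.\<close>

lemma path_walk_loop:
  assumes "l < n"
  shows "(mat_op n (path_mat \<sigma>) ^^ l) (delta (n - 1)) = path_walk n l"
  using assms
proof (induction l)
  case 0
  show ?case by (simp add: path_walk_def)
next
  case (Suc l)
  have "(mat_op n (path_mat \<sigma>) ^^ Suc l) (delta (n - 1)) = mat_op n (path_mat \<sigma>) (path_walk n l)"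
    using Suc by simp
  also have "\<dots> = mat_op n (path_mat 0) (path_walk n l)"
  proof -
    have "0 + l < n - 1" using Suc.prems by linarith
    then have "path_walk n l 0 = 0" using Suc.prems by (intro path_walk_front(1)) auto
    then show ?thesis using path_mat_loop[of n \<sigma> "path_walk n l"] Suc.prems by (simp add: fun_eq_iff)
  qed
  finally show ?case by (simp add: path_walk_def)
qed

text \<open>Closed walks at the vertex \<open>n - 1\<close> need \<open>2 n - 1\<close> steps to use the loop at all, in which case they use
  it once and in one way, and \<open>2 n\<close> steps to use it twice in a row. Hence the moments do not depend on
  \<open>\<sigma>\<close> up to order \<open>2 n - 2\<close>, the one of order \<open>2 n - 1\<close> is a constant plus \<open>\<sigma>\<close>, and the one of order
  \<open>2 n\<close> is a quadratic polynomial in \<open>\<sigma>\<close> with leading coefficient 1.\<close>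

lemma path_mat_moments:
  assumes n: "0 < n" and eb: "eigenbasis n (path_mat \<sigma>) u d"
  shows "m \<le> 2 * n - 2 \<Longrightarrow> (\<Sum>j<n. (u j (n - 1))\<^sup>2 * d j ^ m)
           = (\<Sum>i<n. path_walk n (m div 2) i * path_walk n (m - m div 2) i)"
    and "(\<Sum>j<n. (u j (n - 1))\<^sup>2 * d j ^ (2 * n - 1))
           = (\<Sum>i<n. path_walk n (n - 1) i * path_walk n n i) + \<sigma>"
    and "(\<Sum>j<n. (u j (n - 1))\<^sup>2 * d j ^ (2 * n))
           = (\<Sum>i<n. (path_walk n n i)\<^sup>2) + 2 * \<sigma> * path_walk n n 0 + \<sigma>\<^sup>2"
proof -
  have "n - 1 < n" using n by simp
  note moment = eigenbasis_moment[OF eb path_mat_sym this]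
  show "(\<Sum>j<n. (u j (n - 1))\<^sup>2 * d j ^ m)
           = (\<Sum>i<n. path_walk n (m div 2) i * path_walk n (m - m div 2) i)" if "m \<le> 2 * n - 2"
  proof -
    have "m div 2 < n" "m - m div 2 < n" using that n by linarith+
    moreover have "m div 2 + (m - m div 2) = m" by simp
    ultimately show ?thesis using moment[of "m div 2" "m - m div 2"] by (simp only: path_walk_loop)
  qed
  have 1: "path_walk n (n - 1) 0 = 1" using path_walk_front(2)[of "n - 1" n 0] n by simp
  have 2: "path_walk n n = mat_op n (path_mat 0) (path_walk n (n - 1))"
    using n by (cases n) (simp_all add: path_walk_def)
  have n': "(mat_op n (path_mat \<sigma>) ^^ n) (delta (n - 1)) = (\<lambda>i. path_walk n n i + (if i = 0 then \<sigma> else 0))"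
  proof -
    have "(mat_op n (path_mat \<sigma>) ^^ n) (delta (n - 1)) = mat_op n (path_mat \<sigma>) (path_walk n (n - 1))"
      using path_walk_loop[of "n - 1" n \<sigma>] n by (cases n) simp_all
    also have "\<dots> = (\<lambda>i. path_walk n n i + (if i = 0 then \<sigma> else 0))"
      unfolding path_mat_loop[OF n, of \<sigma> "path_walk n (n - 1)"] 2[symmetric] 1 by (intro ext) simp
    finally show ?thesis .
  qed
  have "(\<Sum>j<n. (u j (n - 1))\<^sup>2 * d j ^ (n - 1 + n))
      = (\<Sum>i<n. path_walk n (n - 1) i * (path_walk n n i + (if i = 0 then \<sigma> else 0)))"
    using moment[of "n - 1" n] path_walk_loop[OF \<open>n - 1 < n\<close>] by (simp only: n')
  also have "\<dots> = (\<Sum>i<n. path_walk n (n - 1) i * path_walk n n i + (if i = 0 then \<sigma> else 0))"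
    by (intro sum.cong) (auto simp: distrib_left 1 simp del: One_nat_def)
  finally show "(\<Sum>j<n. (u j (n - 1))\<^sup>2 * d j ^ (2 * n - 1))
           = (\<Sum>i<n. path_walk n (n - 1) i * path_walk n n i) + \<sigma>"
    using n by (simp add: sum.distrib mult_2)
  have "(\<Sum>j<n. (u j (n - 1))\<^sup>2 * d j ^ (n + n))
      = (\<Sum>i<n. (path_walk n n i + (if i = 0 then \<sigma> else 0)) * (path_walk n n i + (if i = 0 then \<sigma> else 0)))"
    using moment[of n n] by (simp only: n')
  also have "\<dots> = (\<Sum>i<n. (path_walk n n i)\<^sup>2 + (if i = 0 then 2 * \<sigma> * path_walk n n 0 + \<sigma>\<^sup>2 else 0))"
    by (intro sum.cong) (auto simp: power2_eq_square algebra_simps)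
  also have "\<dots> = (\<Sum>i<n. (path_walk n n i)\<^sup>2) + (2 * \<sigma> * path_walk n n 0 + \<sigma>\<^sup>2)"
    unfolding sum.distrib using n by simp
  finally show "(\<Sum>j<n. (u j (n - 1))\<^sup>2 * d j ^ (2 * n))
           = (\<Sum>i<n. (path_walk n n i)\<^sup>2) + 2 * \<sigma> * path_walk n n 0 + \<sigma>\<^sup>2"
    by (simp only: mult_2 add.assoc)
qed

section \<open>Diagonal entries of matrix functions\<close>

lemma matrix_fun_diag_entry:
  assumes "orthonormal_family n u" "r < n"
  shows "Re (matrix_fun f (unitary_conj n (column_mat n u) d) $$ (r, r)) = (\<Sum>j<n. (u j r)\<^sup>2 * f (d j))"
  unfolding matrix_fun_unitary_conj[OF column_mat_unitary[OF assms(1)]] column_mat_conj_index[OF assms(2,2)]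
  by (simp add: power2_eq_square mult_ac)

lemma orthonormal_delta: "orthonormal_family n delta"
proof -
  have "(\<Sum>i<n. delta j i * delta k i) = (if j = k then 1 else 0)" if "j < n" for j k
  proof -
    have "(\<Sum>i<n. delta j i * delta k i) = (\<Sum>i<n. if i = j then if j = k then 1 else 0 else 0)"
      by (intro sum.cong) (auto simp: delta_def)
    then show ?thesis using that by simp
  qed
  then show ?thesis by (simp add: orthonormal_family_def)
qed

definition scalar_mat :: "nat \<Rightarrow> real \<Rightarrow> complex mat" where
  "scalar_mat n x = unitary_conj n (column_mat n delta) (\<lambda>_. x)"

lemma scalar_mat_carrier: "scalar_mat n x \<in> carrier_mat n n"
  by (simp add: scalar_mat_def unitary_conj_carrier)

lemma scalar_mat_index:
  assumes "i < n" "j < n"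
  shows "scalar_mat n x $$ (i, j) = complex_of_real (if i = j then x else 0)"
proof -
  have "(\<Sum>l<n. x * delta l i * delta l j) = x * (\<Sum>l<n. delta l i * delta l j)"
    by (simp add: sum_distrib_left mult.assoc)
  also have "\<dots> = (if i = j then x else 0)"
    using orthonormal_family_complete[OF orthonormal_delta assms] by simp
  finally show ?thesis
    unfolding scalar_mat_def column_mat_conj_index[OF assms] by (simp only:)
qed

lemma scalar_mat_hermitian_on: "x \<in> I \<Longrightarrow> scalar_mat n x \<in> hermitian_mats_on n I"
  by (simp add: scalar_mat_def unitary_conj_hermitian_on column_mat_unitary orthonormal_delta)

lemma matrix_fun_scalar_mat:
  assumes "0 < n"
  shows "Re (matrix_fun f (scalar_mat n x) $$ (0, 0)) = f x"
proof -
  have "(\<Sum>j<n. (delta j 0)\<^sup>2 * f x) = (\<Sum>j<n. if j = 0 then f x else 0)"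
    by (intro sum.cong) (auto simp: delta_def)
  then show ?thesis
    using assms by (simp add: scalar_mat_def matrix_fun_diag_entry[OF orthonormal_delta])
qed

lemma loewner_leI_diag:
  assumes A: "A \<in> hermitian_mats n" and B: "B \<in> hermitian_mats n"
    and diff: "B - A = mat_diag n (\<lambda>i. complex_of_real (g i))" and g: "\<And>i. i < n \<Longrightarrow> 0 \<le> g i"
  shows "loewner_le n A B"
  using A B pos_semidef_mat_diag[of n g, OF g] diff by (simp add: loewner_le_def)

text \<open>Restrict to scalar matrices.\<close>

lemma matrix_monotone_imp_mono_on:
  assumes "0 < n" "matrix_monotone_on n I f"
  shows "mono_on I f"
proof (rule mono_onI)
  fix x y assume xy: "x \<in> I" "y \<in> I" "x \<le> y"
  have "loewner_le n (scalar_mat n x) (scalar_mat n y)"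
  proof (rule loewner_leI_diag[where g = "\<lambda>_. y - x"])
    show "scalar_mat n y - scalar_mat n x = mat_diag n (\<lambda>i. complex_of_real (y - x))"
      using scalar_mat_carrier[of n x] scalar_mat_carrier[of n y]
      by (intro eq_matI) (auto simp: mat_diag_def scalar_mat_index)
  qed (use xy scalar_mat_hermitian_on in \<open>auto simp: hermitian_mats_on_def\<close>)
  then have "loewner_le n (matrix_fun f (scalar_mat n x)) (matrix_fun f (scalar_mat n y))"
    using assms(2) xy scalar_mat_hermitian_on unfolding matrix_monotone_on_def by blast
  from loewner_le_diag_entry[OF this assms(1)] show "f x \<le> f y"
    by (simp add: matrix_fun_scalar_mat assms(1))
qed

lemma matrix_fun_carrier:
  "U \<in> unitary_mats n \<Longrightarrow> matrix_fun f (unitary_conj n U d) \<in> carrier_mat n n"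
  by (simp add: matrix_fun_unitary_conj unitary_conj_carrier unitary_mats_def)

lemma matrix_convex_diag_entry:
  assumes conv: "matrix_convex_on n I f" and t: "0 \<le> t" "t \<le> 1" and r: "r < n"
    and A: "A \<in> hermitian_mats_on n I" "matrix_fun f A \<in> carrier_mat n n"
    and B: "B \<in> hermitian_mats_on n I" "matrix_fun f B \<in> carrier_mat n n"
    and C: "C = complex_of_real t \<cdot>\<^sub>m A + complex_of_real (1 - t) \<cdot>\<^sub>m B"
  shows "Re (matrix_fun f C $$ (r, r))
    \<le> t * Re (matrix_fun f A $$ (r, r)) + (1 - t) * Re (matrix_fun f B $$ (r, r))"
proof -
  have "loewner_le n (matrix_fun f C)
     (complex_of_real t \<cdot>\<^sub>m matrix_fun f A + complex_of_real (1 - t) \<cdot>\<^sub>m matrix_fun f B)"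
    using conv t A(1) B(1) unfolding matrix_convex_on_def C by simp
  from loewner_le_diag_entry[OF this r] show ?thesis
    using A(2) B(2) r by simp
qed

lemma matrix_convex_imp_convex_on:
  assumes n: "0 < n" and conv: "matrix_convex_on n I f" and I: "convex I"
  shows "convex_on I f"
proof (rule convex_onI[OF _ I])
  fix t x y :: real assume t: "0 < t" "t < 1" and xy: "x \<in> I" "y \<in> I"
  have "Re (matrix_fun f (scalar_mat n ((1 - t) * x + t * y)) $$ (0, 0))
    \<le> (1 - t) * Re (matrix_fun f (scalar_mat n x) $$ (0, 0))
      + (1 - (1 - t)) * Re (matrix_fun f (scalar_mat n y) $$ (0, 0))"
  proof (rule matrix_convex_diag_entry[OF conv])
    show "scalar_mat n ((1 - t) * x + t * y)
        = complex_of_real (1 - t) \<cdot>\<^sub>m scalar_mat n x + complex_of_real (1 - (1 - t)) \<cdot>\<^sub>m scalar_mat n y"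
      using scalar_mat_carrier[of n x] scalar_mat_carrier[of n y] scalar_mat_carrier[of n "(1 - t) * x + t * y"]
      by (intro eq_matI) (auto simp: scalar_mat_index)
    show "matrix_fun f (scalar_mat n x) \<in> carrier_mat n n" "matrix_fun f (scalar_mat n y) \<in> carrier_mat n n"
      unfolding scalar_mat_def by (intro matrix_fun_carrier column_mat_unitary orthonormal_delta)+
  qed (use n t xy scalar_mat_hermitian_on in auto)
  then show "f ((1 - t) *\<^sub>R x + t *\<^sub>R y) \<le> (1 - t) * f x + t * f y"
    by (simp add: matrix_fun_scalar_mat n)
qed

section \<open>Tone from monotonicity and convexity\<close>

lemma is_interval_einterval: "is_interval (einterval a b)"
  unfolding is_interval_1
proof (intro ballI allI impI, elim conjE)
  fix x y z assume "x \<in> einterval a b" "y \<in> einterval a b" "x \<le> z" "z \<le> y"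
  then have "a < ereal x" "ereal x \<le> ereal z" "ereal z \<le> ereal y" "ereal y < b"
    by (auto simp: einterval_iff)
  then show "z \<in> einterval a b"
    unfolding einterval_iff by (meson le_less_trans less_le_trans)
qed

lemma path_mat_eigenbases:
  obtains u d where "\<And>\<sigma>. \<sigma> \<in> {-1, 0, 1} \<Longrightarrow> eigenbasis n (path_mat \<sigma>) (u \<sigma>) (d \<sigma>)"
proof -
  have "\<forall>\<sigma>\<in>{-1, 0, 1}. \<exists>r. eigenbasis n (path_mat \<sigma>) (fst r) (snd r)"
    using path_mat_eigenbasis[of _ n] by auto
  from bchoice[OF this] obtain r where
    "\<forall>\<sigma>\<in>{-1, 0, 1}. eigenbasis n (path_mat \<sigma>) (fst (r \<sigma>)) (snd (r \<sigma>))" by blast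
  then show ?thesis by (intro that[of "\<lambda>\<sigma>. fst (r \<sigma>)" "\<lambda>\<sigma>. snd (r \<sigma>)"]) blast
qed

text \<open>With an eigenbasis \<open>u\<close>, \<open>d\<close> of \<open>path_mat \<sigma>\<close> this is the matrix \<open>x 1 + e path_mat \<sigma>\<close>, given in diagonalized
  form so that the functional calculus applies to it.\<close>

definition path_pencil ::
    "nat \<Rightarrow> (nat \<Rightarrow> nat \<Rightarrow> real) \<Rightarrow> (nat \<Rightarrow> real) \<Rightarrow> real \<Rightarrow> real \<Rightarrow> complex mat" where
  "path_pencil n u d x e = unitary_conj n (column_mat n u) (\<lambda>j. x + e * d j)"

lemma path_pencil:
  assumes "eigenbasis n (path_mat \<sigma>) u d"
  shows "path_pencil n u d x e \<in> carrier_mat n n"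
    "(\<And>j. j < n \<Longrightarrow> x + e * d j \<in> I) \<Longrightarrow> path_pencil n u d x e \<in> hermitian_mats_on n I"
    "\<And>i j. i < n \<Longrightarrow> j < n \<Longrightarrow> path_pencil n u d x e $$ (i, j)
       = complex_of_real ((if i = j then x else 0) + e * path_mat \<sigma> i j)"
    "matrix_fun f (path_pencil n u d x e) \<in> carrier_mat n n"
    "r < n \<Longrightarrow> Re (matrix_fun f (path_pencil n u d x e) $$ (r, r)) = (\<Sum>j<n. (u j r)\<^sup>2 * f (x + e * d j))"
proof -
  have on: "orthonormal_family n u" using assms by (simp add: eigenbasis_def)
  then have U: "column_mat n u \<in> unitary_mats n" by (rule column_mat_unitary)
  show "path_pencil n u d x e \<in> carrier_mat n n" by (simp add: path_pencil_def unitary_conj_carrier)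
  show "path_pencil n u d x e \<in> hermitian_mats_on n I" if "\<And>j. j < n \<Longrightarrow> x + e * d j \<in> I"
    unfolding path_pencil_def by (rule unitary_conj_hermitian_on[OF U that])
  show "path_pencil n u d x e $$ (i, j) = complex_of_real ((if i = j then x else 0) + e * path_mat \<sigma> i j)"
    if "i < n" "j < n" for i j
    unfolding path_pencil_def by (rule eigenbasis_unitary_conj[OF assms that])
  show "matrix_fun f (path_pencil n u d x e) \<in> carrier_mat n n"
    unfolding path_pencil_def by (rule matrix_fun_carrier[OF U])
  show "Re (matrix_fun f (path_pencil n u d x e) $$ (r, r)) = (\<Sum>j<n. (u j r)\<^sup>2 * f (x + e * d j))" if "r < n"
    unfolding path_pencil_def by (rule matrix_fun_diag_entry[OF on that])
qed

lemma sum_over_family: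
  fixes q :: "real \<Rightarrow> real"
  shows "(\<Sum>i\<in>T \<times> {..<n}. (case i of (\<sigma>, j) \<Rightarrow> q \<sigma> * w \<sigma> j) * g (case i of (\<sigma>, j) \<Rightarrow> d \<sigma> j))
    = (\<Sum>\<sigma>\<in>T. q \<sigma> * (\<Sum>j<n. w \<sigma> j * g (d \<sigma> j)))"
  unfolding sum_distrib_left sum.cartesian_product
  by (intro sum.cong refl) (auto simp: mult.assoc)

text \<open>The increment from \<open>\<sigma> = 0\<close> to \<open>\<sigma> = 1\<close> is \<open>e\<close> times the projection to the first coordinate, so monotonicity
  compares the last diagonal entries of \<open>f\<close> at the two pencils. The resulting stencil, the difference of
  the spectral measures for \<open>\<sigma> = 1\<close> and \<open>\<sigma> = 0\<close>, has vanishing moments below order \<open>2 n - 1\<close> and moment 1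
  at that order.\<close>

lemma matrix_monotone_imp_k_tone:
  assumes n: "2 \<le> n" and I: "open I" "is_interval I" and mon: "matrix_monotone_on n I f"
  shows "k_tone_on (2 * n - 1) I f"
proof -
  obtain u d where eb: "\<And>\<sigma>. \<sigma> \<in> {-1, 0, 1} \<Longrightarrow> eigenbasis n (path_mat \<sigma>) (u \<sigma>) (d \<sigma>)"
    using path_mat_eigenbases[of n] by blast
  have n0: "0 < n" using n by simp
  define w where "w \<sigma> j = (u \<sigma> j (n - 1))\<^sup>2" for \<sigma> j
  \<comment> \<open>A node of the stencil is indexed by a loop weight \<open>\<sigma>\<close> and the number \<open>j\<close> of an eigenvalue; \<open>q \<sigma>\<close> is
    the factor with which the spectral measure for \<open>\<sigma>\<close> enters.\<close>
  define q :: "real \<Rightarrow> real" where "q \<sigma> = (if \<sigma> = 0 then -1 else 1)" for \<sigma>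
  define c where "c = (\<lambda>(\<sigma>, j). q \<sigma> * w \<sigma> j)"
  define p where "p = (\<lambda>(\<sigma>, j). d \<sigma> j)"
  let ?K = "{0, 1} \<times> {..<n}"
  have sum: "(\<Sum>i\<in>?K. c i * g (p i)) = (\<Sum>j<n. w 1 j * g (d 1 j)) - (\<Sum>j<n. w 0 j * g (d 0 j))" for g
    unfolding c_def p_def sum_over_family by (simp add: q_def)
  note moments = path_mat_moments[OF n0 eb, folded w_def]
  show ?thesis
  proof (rule mono_stencil_imp_k_tone[where K = ?K and c = c and p = p])
    show "(\<Sum>i\<in>?K. c i * p i ^ m) = 0" if "m < 2 * n - 1" for m
      using that moments(1)[of 0 m] moments(1)[of 1 m] unfolding sum[of "\<lambda>y. y ^ m"] by simp
    show "0 < (\<Sum>i\<in>?K. c i * p i ^ (2 * n - 1))"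
      using moments(2)[of 0] moments(2)[of 1] unfolding sum[of "\<lambda>y. y ^ (2 * n - 1)"] by simp
    show "mono_on I f" by (rule matrix_monotone_imp_mono_on[OF n0 mon])
    show "stencil_nonneg_on ?K c p I f"
      unfolding stencil_nonneg_on_def
    proof (intro allI impI, elim conjE)
      fix x e :: real assume e: "0 < e" and xI: "\<forall>i\<in>?K. x + e * p i \<in> I"
      define X where "X \<sigma> = path_pencil n (u \<sigma>) (d \<sigma>) x e" for \<sigma>
      have X: "X \<sigma> \<in> hermitian_mats_on n I" if "\<sigma> \<in> {0, 1}" for \<sigma>
        unfolding X_def
      proof (rule path_pencil(2)[OF eb])
        show "\<sigma> \<in> {-1, 0, 1}" using that by auto
        fix j assume "j < n"
        then show "x + e * d \<sigma> j \<in> I" using bspec[OF xI, of "(\<sigma>, j)"] that by (simp add: p_def)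
      qed
      have Xc: "X 0 \<in> carrier_mat n n" "X 1 \<in> carrier_mat n n"
        unfolding X_def by (rule path_pencil(1)[OF eb], simp)+
      have "loewner_le n (X 0) (X 1)"
      proof (rule loewner_leI_diag[where g = "\<lambda>i. if i = 0 then e else 0"])
        show "X 1 - X 0 = mat_diag n (\<lambda>i. complex_of_real (if i = 0 then e else 0))"
        proof (rule eq_matI)
          fix i j assume "i < dim_row (mat_diag n (\<lambda>i. complex_of_real (if i = 0 then e else 0)))"
            "j < dim_col (mat_diag n (\<lambda>i. complex_of_real (if i = 0 then e else 0)))"
          then have ij: "i < n" "j < n" by (auto simp: mat_diag_def)
          have "X 0 $$ (i, j) = complex_of_real ((if i = j then x else 0) + e * path_mat 0 i j)"
            "X 1 $$ (i, j) = complex_of_real ((if i = j then x else 0) + e * path_mat 1 i j)"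
            unfolding X_def by (rule path_pencil(3)[OF eb ij], simp)+
          then show "(X 1 - X 0) $$ (i, j) = mat_diag n (\<lambda>i. complex_of_real (if i = 0 then e else 0)) $$ (i, j)"
            using ij Xc by (auto simp: mat_diag_def path_mat_def)
        qed (use Xc in \<open>auto simp: mat_diag_def\<close>)
      qed (use e X in \<open>auto simp: hermitian_mats_on_def\<close>)
      then have "loewner_le n (matrix_fun f (X 0)) (matrix_fun f (X 1))"
        using mon X unfolding matrix_monotone_on_def by simp
      then have "Re (matrix_fun f (X 0) $$ (n - 1, n - 1)) \<le> Re (matrix_fun f (X 1) $$ (n - 1, n - 1))"
        by (rule loewner_le_diag_entry) (use n0 in simp)
      moreover have "Re (matrix_fun f (X \<sigma>) $$ (n - 1, n - 1)) = (\<Sum>j<n. w \<sigma> j * f (x + e * d \<sigma> j))"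
        if "\<sigma> \<in> {0, 1}" for \<sigma>
        unfolding X_def w_def by (rule path_pencil(5)[OF eb]) (use n0 that in auto)
      ultimately show "0 \<le> (\<Sum>i\<in>?K. c i * f (x + e * p i))"
        unfolding sum[of "\<lambda>y. f (x + e * y)"] by simp
    qed
  qed (use n I in auto)
qed

text \<open>The pencil for \<open>\<sigma> = 0\<close> is the midpoint of those for \<open>\<sigma> = 1\<close> and \<open>\<sigma> = -1\<close>. The second difference in \<open>\<sigma>\<close>
  of the moments kills the part that is affine in \<open>\<sigma>\<close>; by the formulas for the moments it vanishes
  below order \<open>2 n\<close> and equals 1 at order \<open>2 n\<close>.\<close>

lemma matrix_convex_imp_k_tone:
  assumes n: "2 \<le> n" and ab: "a < b" and conv: "matrix_convex_on n (einterval a b) f"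
  shows "k_tone_on (2 * n) (einterval a b) f"
proof -
  obtain u d where eb: "\<And>\<sigma>. \<sigma> \<in> {-1, 0, 1} \<Longrightarrow> eigenbasis n (path_mat \<sigma>) (u \<sigma>) (d \<sigma>)"
    using path_mat_eigenbases[of n] by blast
  let ?I = "einterval a b"
  have n0: "0 < n" using n by simp
  define w where "w \<sigma> j = (u \<sigma> j (n - 1))\<^sup>2" for \<sigma> j
  \<comment> \<open>A node of the stencil is indexed by a loop weight \<open>\<sigma>\<close> and the number \<open>j\<close> of an eigenvalue; \<open>q \<sigma>\<close> is
    the factor with which the spectral measure for \<open>\<sigma>\<close> enters.\<close>
  define q :: "real \<Rightarrow> real" where "q \<sigma> = (if \<sigma> = 0 then -1 else 1 / 2)" for \<sigma>
  define c where "c = (\<lambda>(\<sigma>, j). q \<sigma> * w \<sigma> j)"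
  define p where "p = (\<lambda>(\<sigma>, j). d \<sigma> j)"
  let ?K = "{-1, 0, 1} \<times> {..<n}"
  have sum: "(\<Sum>i\<in>?K. c i * g (p i)) = (1 / 2) * (\<Sum>j<n. w 1 j * g (d 1 j))
      + (1 / 2) * (\<Sum>j<n. w (-1) j * g (d (-1) j)) - (\<Sum>j<n. w 0 j * g (d 0 j))" for g
    unfolding c_def p_def sum_over_family by (simp add: q_def)
  note moments = path_mat_moments[OF n0 eb, folded w_def]
  show ?thesis
  proof (rule stencil_imp_k_tone[where K = ?K and c = c and p = p])
    show "(\<Sum>i\<in>?K. c i * p i ^ m) = 0" if "m < 2 * n" for m
    proof (cases "m = 2 * n - 1")
      case True
      show ?thesis
        using moments(2)[of 0] moments(2)[of 1] moments(2)[of "-1"]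
        unfolding True sum[of "\<lambda>y. y ^ (2 * n - 1)"]
        by (simp add: add_divide_distrib diff_divide_distrib)
    next
      case False
      then have "m \<le> 2 * n - 2" using that by simp
      then show ?thesis
        using moments(1)[of 0 m] moments(1)[of 1 m] moments(1)[of "-1" m]
        unfolding sum[of "\<lambda>y. y ^ m"] by simp
    qed
    show "0 < (\<Sum>i\<in>?K. c i * p i ^ (2 * n))"
      using moments(3)[of 0] moments(3)[of 1] moments(3)[of "-1"]
      unfolding sum[of "\<lambda>y. y ^ (2 * n)"]
      by (simp add: add_divide_distrib diff_divide_distrib)
    have "convex_on ?I f"
      using matrix_convex_imp_convex_on[OF n0 conv] is_interval_einterval is_interval_convex_1 by blast
    then show "continuous_on ?I f" by (intro convex_on_continuous) auto
    show "stencil_nonneg_on ?K c p ?I f"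
      unfolding stencil_nonneg_on_def
    proof (intro allI impI, elim conjE)
      fix x e :: real assume e: "0 < e" and xI: "\<forall>i\<in>?K. x + e * p i \<in> ?I"
      define X where "X \<sigma> = path_pencil n (u \<sigma>) (d \<sigma>) x e" for \<sigma>
      have X: "X \<sigma> \<in> hermitian_mats_on n ?I" if "\<sigma> \<in> {-1, 0, 1}" for \<sigma>
        unfolding X_def
      proof (rule path_pencil(2)[OF eb[OF that]])
        fix j assume "j < n"
        then show "x + e * d \<sigma> j \<in> ?I" using bspec[OF xI, of "(\<sigma>, j)"] that by (simp add: p_def)
      qed
      have Xc: "X \<sigma> \<in> carrier_mat n n" and fXc: "matrix_fun f (X \<sigma>) \<in> carrier_mat n n"
        if "\<sigma> \<in> {-1, 0, 1}" for \<sigma>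
        unfolding X_def by (rule path_pencil(1)[OF eb[OF that]], rule path_pencil(4)[OF eb[OF that]])
      have "X 0 = complex_of_real (1 / 2) \<cdot>\<^sub>m X 1 + complex_of_real (1 - 1 / 2) \<cdot>\<^sub>m X (-1)" (is "_ = ?R")
      proof (rule eq_matI)
        fix i j assume "i < dim_row ?R" "j < dim_col ?R"
        then have ij: "i < n" "j < n" using Xc[of "-1"] by auto
        have "X \<sigma> $$ (i, j) = complex_of_real ((if i = j then x else 0) + e * path_mat \<sigma> i j)"
          if "\<sigma> \<in> {-1, 0, 1}" for \<sigma>
          unfolding X_def by (rule path_pencil(3)[OF eb[OF that] ij])
        then show "X 0 $$ (i, j) = ?R $$ (i, j)"
          using ij Xc[of "-1"] Xc[of 1] by (auto simp: path_mat_def field_simps)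
      qed (use Xc[of 0] Xc[of 1] Xc[of "-1"] in auto)
      then have "Re (matrix_fun f (X 0) $$ (n - 1, n - 1))
          \<le> 1 / 2 * Re (matrix_fun f (X 1) $$ (n - 1, n - 1))
            + (1 - 1 / 2) * Re (matrix_fun f (X (-1)) $$ (n - 1, n - 1))"
        by (intro matrix_convex_diag_entry[OF conv] X fXc) (use n0 in auto)
      moreover have "Re (matrix_fun f (X \<sigma>) $$ (n - 1, n - 1)) = (\<Sum>j<n. w \<sigma> j * f (x + e * d \<sigma> j))"
        if "\<sigma> \<in> {-1, 0, 1}" for \<sigma>
        unfolding X_def w_def by (rule path_pencil(5)[OF eb[OF that]]) (use n0 in simp)
      ultimately show "0 \<le> (\<Sum>i\<in>?K. c i * f (x + e * p i))"
        unfolding sum[of "\<lambda>y. f (x + e * y)"] by simp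
    qed
  qed (use n ab in auto)
qed

theorem corollary1p6:
  fixes n :: nat and a b :: ereal and f :: "real \<Rightarrow> real"
  assumes "2 \<le> n" and "a < b"
  shows "(matrix_monotone_on n (einterval a b) f \<longrightarrow>
            k_tone_on (2 * n - 1) (einterval a b) f \<and> C_k_on (2 * n - 3) (einterval a b) f) \<and>
         (matrix_convex_on n (einterval a b) f \<longrightarrow>
            k_tone_on (2 * n) (einterval a b) f \<and> C_k_on (2 * n - 2) (einterval a b) f)"
proof (intro conjI impI)
  let ?I = "einterval a b"
  assume mon: "matrix_monotone_on n ?I f"
  show tone: "k_tone_on (2 * n - 1) ?I f"
    by (rule matrix_monotone_imp_k_tone[OF assms(1) open_einterval is_interval_einterval mon])
  have "2 * n - 1 = 2 * n - 3 + 2" using assms(1) by simp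
  with tone show "C_k_on (2 * n - 3) ?I f"
    by (intro k_tone_imp_C_k[OF open_einterval is_interval_einterval]) simp
next
  let ?I = "einterval a b"
  assume conv: "matrix_convex_on n ?I f"
  show tone: "k_tone_on (2 * n) ?I f"
    by (rule matrix_convex_imp_k_tone[OF assms conv])
  have "2 * n = 2 * n - 2 + 2" using assms(1) by simp
  with tone show "C_k_on (2 * n - 2) ?I f"
    by (intro k_tone_imp_C_k[OF open_einterval is_interval_einterval]) simp
qed

end
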